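(* Let a group $G$ act transitively on a finite set $\Omega$, and let $S\subseteq G$ be a finite symmetric multiset. If $gap(G\circlearrowleft\Omega,S)\ge\varepsilon>0$, then $$|S|\ \ge\ \frac{2\log\Theta(G\circlearrowleft\Omega)}{\log(5/\varepsilon)}.$$
   Context: For a finite $d$-regular undirected graph $\Gamma$ (loops and multiple edges allowed), the averaging operator is $\mathbf M\mathbf v(x)=\frac1d\sum_{y\sim x}\mathbf v(y)$ (with multiplicity); its eigenvalues are $1=\lambda_1\ge\lambda_2\ge\dots\ge\lambda_{|\Gamma|}\ge-1$ and $gap(\Gamma):=1-\lambda_2$. A multiset $S\subseteq G$ is symmetric if each element appears with the same multiplicity as its inverse. The Schreier graph $Sch(G\circlearrowleft\Omega,S)$ is the $|S|$-regular graph with vertex set $\Omega$ and edges $(\omega,\omega^s)$ for $\omega\in\Omega$, $s\in S$ (with multiplicity), and $gap(G\circlearrowleft\Omega,S):=gap(Sch(G\circlearrowleft\Omega,S))$. Fixing $\omega\in\Omega$, $$\Theta(G\circlearrowleft\Omega):=\max_{Stab(\omega)\le H\le G}|H/H'Stab(\omega)|^{1/|G:H|},$$ where $H'=[H,H]$ is the commutator subgroup of $H$ and $|H/H'Stab(\omega)|$ denotes the index $|H:H'Stab(\omega)|$ (this does not depend on $\omega$).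
   Formalization: S is assumed nonempty (so that the gap is defined), and the case |Ω| = 2, |S| = 1, ε > 5/4 is excluded because the claim fails there: for C_2 acting on two points with S = {s}, the gap is 2 and Θ = 2, and ε = 2 would require 1 ≥ 1.51. *)

theory Defs
  imports "HOL-Algebra.Algebra" "Jordan_Normal_Form.Char_Poly" Complex_Main
begin

text \<open>
  A multigraph is given by its vertices and, for each vertex, the multiset of its neighbours
  (the other ends of the edges at that vertex, with multiplicity).  A loop contributes
  one to the degree.
\<close>

record 'v multigraph =
  vertices :: "'v set"
  nbrs :: "'v \<Rightarrow> 'v multiset"

definition regular_graph :: "nat \<Rightarrow> 'v multigraph \<Rightarrow> bool" where
  "regular_graph d \<Gamma> \<longleftrightarrow> finite (vertices \<Gamma>) \<and>
     (\<forall>x \<in> vertices \<Gamma>. set_mset (nbrs \<Gamma> x) \<subseteq> vertices \<Gamma> \<and> size (nbrs \<Gamma> x) = d) \<and>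
     (\<forall>x \<in> vertices \<Gamma>. \<forall>y \<in> vertices \<Gamma>. count (nbrs \<Gamma> x) y = count (nbrs \<Gamma> y) x)"

definition averaging_op :: "'v multigraph \<Rightarrow> ('v \<Rightarrow> real) \<Rightarrow> 'v \<Rightarrow> real" where
  "averaging_op \<Gamma> v x = (1 / real (size (nbrs \<Gamma> x))) * (\<Sum>y \<in># nbrs \<Gamma> x. v y)"

definition averaging_mat :: "'v multigraph \<Rightarrow> 'v list \<Rightarrow> real mat" where
  "averaging_mat \<Gamma> xs =
     mat (length xs) (length xs) (\<lambda>(i, j). averaging_op \<Gamma> (\<lambda>x. of_bool (x = xs ! j)) (xs ! i))"

definition averaging_char_poly :: "'v multigraph \<Rightarrow> real poly" where
  "averaging_char_poly \<Gamma> =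
     char_poly (averaging_mat \<Gamma> (SOME xs. distinct xs \<and> set xs = vertices \<Gamma>))"

text \<open>
  All eigenvalues with multiplicity, in descending order; the matrix is symmetric for a
  regular graph, so its characteristic polynomial splits over the reals.
\<close>

definition eigenvalue_list :: "'v multigraph \<Rightarrow> real list" where
  "eigenvalue_list \<Gamma> = rev (sorted_list_of_multiset (proots (averaging_char_poly \<Gamma>)))"

text \<open>
  List positions start at 0, so index 1 is the second largest eigenvalue.
  The value is meaningful only for at least two vertices and positive degree.
  The gap of two vertices joined by a single edge is 2; there \<open>Theta\<close> is 2 as well, and
  \<open>1 \<ge> 2 * ln 2 / ln (5 / \<epsilon>)\<close> holds exactly for \<open>0 < \<epsilon> \<le> 5 / 4\<close> (in the range \<open>\<epsilon> \<le> 2\<close>).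
\<close>

definition gap :: "'v multigraph \<Rightarrow> real" where
  "gap \<Gamma> = 1 - eigenvalue_list \<Gamma> ! 1"

definition symmetric_mset :: "('g, 'm) monoid_scheme \<Rightarrow> 'g multiset \<Rightarrow> bool" where
  "symmetric_mset G S \<longleftrightarrow> set_mset S \<subseteq> carrier G \<and>
     (\<forall>g \<in> carrier G. count S (inv\<^bsub>G\<^esub> g) = count S g)"

text \<open>
  Actions are left actions here.  A right action is recovered as
  \<open>\<omega>\<^sup>g = \<phi> (inv g) \<omega>\<close>; stabilizers agree, and for symmetric \<open>S\<close> so does the Schreier graph.
\<close>

definition schreier_graph ::
    "'x set \<Rightarrow> ('g \<Rightarrow> 'x \<Rightarrow> 'x) \<Rightarrow> 'g multiset \<Rightarrow> 'x multigraph" where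
  "schreier_graph \<Omega> \<phi> S =
     \<lparr>vertices = \<Omega>, nbrs = (\<lambda>\<omega>. image_mset (\<lambda>s. \<phi> s \<omega>) S)\<rparr>"

definition subgroup_index :: "('g, 'm) monoid_scheme \<Rightarrow> 'g set \<Rightarrow> 'g set \<Rightarrow> nat" where
  "subgroup_index G H K = card (rcosets\<^bsub>G\<lparr>carrier := H\<rparr>\<^esub> K)"

text \<open>
  For a transitive action on a finite set the stabilizer has finite index, so there are only
  finitely many \<open>H\<close> and all indices below are finite.
\<close>

definition Theta :: "('g, 'm) monoid_scheme \<Rightarrow> ('g \<Rightarrow> 'x \<Rightarrow> 'x) \<Rightarrow> 'x \<Rightarrow> real" where
  "Theta G \<phi> \<omega> =
     Max {real (subgroup_index G H (derived G H <#>\<^bsub>G\<^esub> stabilizer G \<phi> \<omega>))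
            powr (1 / real (subgroup_index G (carrier G) H)) | H.
          subgroup H G \<and> stabilizer G \<phi> \<omega> \<subseteq> H}"

lemma averaging_char_poly_eq:
  assumes "distinct ys" "set ys = vertices \<Gamma>"
  shows "averaging_char_poly \<Gamma> = char_poly (averaging_mat \<Gamma> ys)"
proof -
  define xs where "xs = (SOME xs. distinct xs \<and> set xs = vertices \<Gamma>)"
  have xs: "distinct xs" "set xs = vertices \<Gamma>"
    using someI[of "\<lambda>xs. distinct xs \<and> set xs = vertices \<Gamma>" ys] assms by (auto simp: xs_def)
  define n where "n = length ys"
  have len: "length xs = n"
    using xs assms distinct_card unfolding n_def by metis
  define p where "p i = (THE k. k < n \<and> ys ! k = xs ! i)" for i
  have p: "p i < n \<and> ys ! p i = xs ! i" if "i < n" for i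
  proof -
    have "xs ! i \<in> set ys" using that xs assms len by (metis nth_mem)
    hence "\<exists>!k. k < n \<and> ys ! k = xs ! i"
      using assms(1) unfolding n_def by (metis in_set_conv_nth nth_eq_iff_index_eq)
    thus ?thesis unfolding p_def by (rule theI')
  qed
  have p_inj: "p i = p j \<longleftrightarrow> i = j" if "i < n" "j < n" for i j
    using p[OF that(1)] p[OF that(2)] that xs(1) len by (metis nth_eq_iff_index_eq)
  have "inj_on p {..<n}" using p_inj by (auto intro: inj_onI)
  moreover have "p ` {..<n} \<subseteq> {..<n}" using p by auto
  ultimately have p_surj: "p ` {..<n} = {..<n}" by (simp add: endo_inj_surj)
  define A where "A = averaging_mat \<Gamma> ys"
  define B where "B = averaging_mat \<Gamma> xs"
  define P :: "real mat" where "P = mat n n (\<lambda>(i, j). if j = p i then 1 else 0)"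
  define Q :: "real mat" where "Q = mat n n (\<lambda>(i, j). if i = p j then 1 else 0)"
  have A: "A \<in> carrier_mat n n" and B: "B \<in> carrier_mat n n"
    by (simp_all add: A_def B_def averaging_mat_def n_def len)
  have P: "P \<in> carrier_mat n n" and Q: "Q \<in> carrier_mat n n"
    by (simp_all add: P_def Q_def)
  have mult_entry: "(R * T) $$ (i, j) = (\<Sum>k = 0..<n. R $$ (i, k) * T $$ (k, j))"
    if "R \<in> carrier_mat n n" "T \<in> carrier_mat n n" "i < n" "j < n" for R T :: "real mat" and i j
    using that by (simp add: scalar_prod_def)
  have PA: "(P * A) $$ (i, j) = A $$ (p i, j)" if "i < n" "j < n" for i j
  proof -
    have "(P * A) $$ (i, j) = (\<Sum>k = 0..<n. P $$ (i, k) * A $$ (k, j))"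
      using mult_entry[OF P A that] .
    also have "\<dots> = (\<Sum>k = 0..<n. (if k = p i then A $$ (k, j) else 0))"
      using that by (intro sum.cong) (auto simp: P_def)
    also have "\<dots> = A $$ (p i, j)" using p[OF that(1)] by simp
    finally show ?thesis .
  qed
  have PAQ: "P * A * Q = B"
  proof (rule eq_matI)
    fix i j assume "i < dim_row B" "j < dim_col B"
    hence ij: "i < n" "j < n" using B by auto
    have "(P * A * Q) $$ (i, j) = (\<Sum>k = 0..<n. (P * A) $$ (i, k) * Q $$ (k, j))"
      using mult_entry[OF mult_carrier_mat[OF P A] Q ij] .
    also have "\<dots> = (\<Sum>k = 0..<n. (if k = p j then A $$ (p i, k) else 0))"
      using ij by (intro sum.cong) (auto simp: PA Q_def simp del: index_mult_mat)
    also have "\<dots> = A $$ (p i, p j)" using p[OF ij(2)] by simp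
    also have "\<dots> = B $$ (i, j)"
      using ij p[OF ij(1)] p[OF ij(2)] len by (simp add: A_def B_def averaging_mat_def n_def)
    finally show "(P * A * Q) $$ (i, j) = B $$ (i, j)" .
  qed (use B P Q in auto)
  have PQ: "P * Q = 1\<^sub>m n"
  proof (rule eq_matI)
    fix i j assume "i < dim_row (1\<^sub>m n :: real mat)" "j < dim_col (1\<^sub>m n :: real mat)"
    hence ij: "i < n" "j < n" by auto
    have "(P * Q) $$ (i, j) = (\<Sum>k = 0..<n. P $$ (i, k) * Q $$ (k, j))"
      using mult_entry[OF P Q ij] .
    also have "\<dots> = (\<Sum>k = 0..<n. (if k = p i then (if p i = p j then 1 else 0) else 0))"
      using ij by (intro sum.cong) (auto simp: P_def Q_def)
    also have "\<dots> = (if i = j then 1 else 0)" using p[OF ij(1)] p_inj[OF ij] by simp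
    finally show "(P * Q) $$ (i, j) = 1\<^sub>m n $$ (i, j)" using ij by simp
  qed (use P Q in auto)
  have QP: "Q * P = 1\<^sub>m n" using mat_mult_left_right_inverse[OF P Q PQ] .
  have "similar_mat B A"
    unfolding similar_mat_def similar_mat_wit_def Let_def
    by (rule exI[of _ P], rule exI[of _ Q]) (simp add: A B P Q PQ QP PAQ carrier_matD[OF B])
  thus ?thesis
    using char_poly_similar unfolding averaging_char_poly_def A_def B_def xs_def by blast
qed

lemma schreier_graph_regular:
  fixes G (structure)
  assumes "group_action G \<Omega> \<phi>" "finite \<Omega>" "symmetric_mset G S"
  shows "regular_graph (size S) (schreier_graph \<Omega> \<phi> S)"
proof -
  interpret group_action G \<Omega> \<phi> by fact
  interpret group G using group_hom group_hom.axioms(1) by auto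
  have S: "set_mset S \<subseteq> carrier G" and sym: "\<And>g. g \<in> carrier G \<Longrightarrow> count S (inv g) = count S g"
    using assms(3) by (auto simp: symmetric_mset_def)
  have inv_S: "inv s \<in># S" if "s \<in># S" for s
    using that S sym[of s] by (metis count_eq_zero_iff subsetD)
  have sub: "\<phi> s x \<in> \<Omega>" if "s \<in># S" "x \<in> \<Omega>" for s x
    using that S element_image by blast
  have le: "count (image_mset (\<lambda>s. \<phi> s x) S) y = count (image_mset (\<lambda>s. \<phi> s y) S) x"
    if xy: "x \<in> \<Omega>" "y \<in> \<Omega>" for x y
    unfolding count_image_mset
  proof (rule sum.reindex_bij_witness[of _ "\<lambda>s. inv s" "\<lambda>s. inv s"], goal_cases)
    case (1 s)
    then show ?case using S by auto
  next
    case (2 s)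
    then have "s \<in> carrier G" "\<phi> s x = y" using S by auto
    hence "\<phi> (inv s) y = x" using orbit_sym_aux[of s x y] xy by auto
    then show ?case using 2 inv_S by auto
  next
    case (3 s)
    then show ?case using S by auto
  next
    case (4 s)
    then have "s \<in> carrier G" "\<phi> s y = x" using S by auto
    hence "\<phi> (inv s) x = y" using orbit_sym_aux[of s y x] xy by auto
    then show ?case using 4 inv_S by auto
  next
    case (5 s)
    then show ?case using S sym by auto
  qed
  show ?thesis
    using assms(2) sub le by (auto simp: regular_graph_def schreier_graph_def)
qed

end

theory Submission
  imports Defs "HOL-Analysis.Function_Topology" "Jordan_Normal_Form.Column_Operations"
begin

text \<open>
  Let \<open>H\<close> attain the maximum in \<open>Theta\<close>, let \<open>K = H' Stab\<close>, \<open>n = |G : H|\<close> and \<open>m = |H : K|\<close>; the claim is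
  \<open>m\<^sup>2 \<le> (5 / \<epsilon>)\<close> to the power \<open>n |S|\<close>.  The abelian group \<open>H / K\<close> has \<open>m\<close> characters, and each of
  them labels the \<open>n |S|\<close> directed edges of \<open>Sch(G / H, S)\<close> by unit complex numbers, inverse edges
  getting conjugate labels.  Inducing a nontrivial character to \<open>G\<close> produces a function of modulus
  \<open>1\<close> and sum \<open>0\<close> on the Schreier graph whose Rayleigh quotient is a mean of real parts of labels;
  so the spectral gap forces some label to have real part at most \<open>1 - \<epsilon>\<close>.  If \<open>m\<close> were larger, the
  pigeonhole principle on arcs of length \<open>2 pi / q\<close>, \<open>q = \<lfloor>5 / \<epsilon>\<rfloor>\<close>, would give two characters with
  close labels everywhere, and their quotient would contradict this.  The arcs are short enough
  for \<open>\<epsilon> \<le> 5 / 4\<close>; a larger gap leaves only complete graphs on at most four vertices, where the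
  trivial bound \<open>m \<le> card \<Omega>\<close> is enough.
\<close>

section \<open>Spectral gap and Rayleigh quotients\<close>

text \<open>First-order condition at a maximum: for \<open>a \<noteq> 0\<close>, at
  \<open>t = a / c\<close> with \<open>c > 0\<close> and \<open>c > b\<close>, the quadratic term is
  strictly smaller than the linear one.\<close>

lemma linear_coeff_zero:
  fixes a b :: real
  assumes "\<And>t. a * t \<le> b * t\<^sup>2"
  shows "a = 0"
proof (rule ccontr)
  assume a: "a \<noteq> 0"
  define c where "c = \<bar>b\<bar> + 1"
  have c: "c > 0" "b < c" by (auto simp: c_def)
  have "a * (a / c) \<le> b * (a / c)\<^sup>2" by (rule assms)
  also have "\<dots> < c * (a / c)\<^sup>2" using a c by (intro mult_strict_right_mono) auto
  also have "\<dots> = a * (a / c)" using c by (simp add: power2_eq_square)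
  finally show False by simp
qed

text \<open>Variational argument: the quadratic form of \<open>a\<close> attains its maximum on the
  unit sphere of mean-zero functions, and moving from the maximiser \<open>f\<close> along its
  residual shows that the residual is zero. Constant row sums and symmetry keep the residual
  mean-zero; \<open>u0\<close> makes the sphere nonempty.\<close>

lemma ex_max_rayleigh_mean_zero:
  fixes a :: "'v \<Rightarrow> 'v \<Rightarrow> real" and u0 :: "'v \<Rightarrow> real"
  assumes V: "finite V" and sym: "\<And>x y. x \<in> V \<Longrightarrow> y \<in> V \<Longrightarrow> a x y = a y x"
    and row: "\<And>x. x \<in> V \<Longrightarrow> (\<Sum>y\<in>V. a x y) = c"
    and u0: "(\<Sum>x\<in>V. u0 x) = 0" "x0 \<in> V" "u0 x0 \<noteq> 0"
  obtains f \<mu> where "(\<Sum>x\<in>V. f x) = 0" "\<exists>x\<in>V. f x \<noteq> 0"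
    "\<And>x. x \<in> V \<Longrightarrow> (\<Sum>y\<in>V. a x y * f y) = \<mu> * f x"
    "\<And>u. (\<Sum>x\<in>V. u x) = 0 \<Longrightarrow> (\<Sum>x\<in>V. u x * (\<Sum>y\<in>V. a x y * u y)) \<le> \<mu> * (\<Sum>x\<in>V. (u x)\<^sup>2)"
proof -
  define B where "B f g = (\<Sum>x\<in>V. f x * (\<Sum>y\<in>V. a x y * g y))" for f g
  define P where "P f g = (\<Sum>x\<in>V. f x * g x)" for f g :: "'v \<Rightarrow> real"
  \<comment> \<open>Forcing the value 0 off \<open>V\<close> makes this a closed part of a product
    of compact sets, so Tychonoff applies. The bounds -1 and 1 cut nothing off the unit
    sphere.\<close>
  define K where "K = {f \<in> PiE UNIV (\<lambda>x. if x \<in> V then {-1..1} else {0}).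
    (\<Sum>x\<in>V. f x) = 0 \<and> P f f = (1::real)}"
  have coord[continuous_intros]: "continuous_on S (\<lambda>f. f x)" for S :: "('v \<Rightarrow> real) set" and x
    by (rule continuous_on_subset[OF continuous_on_product_coordinates]) auto
  have cpt: "compact (PiE UNIV (\<lambda>x. if x \<in> V then {-1..1} else {0::real}))"
  proof -
    have "compactin (product_topology (\<lambda>_. euclidean) UNIV)
        (PiE UNIV (\<lambda>x. if x \<in> V then {-1..1} else {0::real}))"
      unfolding compactin_PiE by auto
    thus ?thesis by (simp add: euclidean_product_topology)
  qed
  have "closed {f. (\<Sum>x\<in>V. f x) = 0 \<and> P f f = (1::real)}"
    unfolding P_def by (intro closed_Collect_conj closed_Collect_eq continuous_intros)
  hence "compact (PiE UNIV (\<lambda>x. if x \<in> V then {-1..1} else {0::real})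
      \<inter> {f. (\<Sum>x\<in>V. f x) = 0 \<and> P f f = (1::real)})"
    by (rule compact_Int_closed[OF cpt])
  moreover have "\<dots> = K" unfolding K_def by auto
  ultimately have K: "compact K" by simp
  have pos: "P u u > 0" if "x \<in> V" "u x \<noteq> 0" for u x
    unfolding P_def using that V by (intro sum_pos2[of V x]) (auto simp: zero_less_mult_iff)
  have normalize: "(\<lambda>x. if x \<in> V then u x / sqrt (P u u) else 0) \<in> K"
    if u: "(\<Sum>x\<in>V. u x) = 0" "P u u > 0" for u
  proof -
    let ?s = "sqrt (P u u)"
    have s: "?s > 0" "?s * ?s = P u u" using u by auto
    have "\<bar>u x\<bar> \<le> ?s" if "x \<in> V" for x
    proof -
      have "u x * u x \<le> P u u" unfolding P_def
        using that V by (intro member_le_sum) auto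
      thus ?thesis by (metis real_sqrt_abs2 real_sqrt_le_iff)
    qed
    hence "u x / ?s \<in> {-1..1}" if "x \<in> V" for x
      using that s(1) by (fastforce simp: abs_le_iff pos_divide_le_eq pos_le_divide_eq)
    moreover have "(\<Sum>x\<in>V. u x / ?s) = 0" using u by (simp flip: sum_divide_distrib)
    moreover have "(\<Sum>x\<in>V. u x / ?s * (u x / ?s)) = 1"
    proof -
      have "(\<Sum>x\<in>V. u x / ?s * (u x / ?s)) = P u u / (?s * ?s)"
        unfolding P_def sum_divide_distrib by (simp add: field_simps)
      thus ?thesis using s u by simp
    qed
    ultimately show ?thesis unfolding K_def P_def by (auto cong: if_cong)
  qed
  have "K \<noteq> {}" using normalize[of u0] pos[of x0 u0] u0 by auto
  moreover have "continuous_on K (\<lambda>f. B f f)"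
    unfolding B_def by (intro continuous_intros)
  ultimately obtain f where f: "f \<in> K" and max: "\<And>g. g \<in> K \<Longrightarrow> B g g \<le> B f f"
    using continuous_attains_sup[OF K] by blast
  define \<mu> where "\<mu> = B f f"
  have f0: "(\<Sum>x\<in>V. f x) = 0" and ff: "P f f = 1" using f by (auto simp: K_def)
  have le: "B u u \<le> \<mu> * P u u" if u: "(\<Sum>x\<in>V. u x) = 0" for u
  proof (cases "P u u > 0")
    case True
    let ?s = "sqrt (P u u)"
    let ?v = "\<lambda>x. if x \<in> V then u x / ?s else 0"
    have "B ?v ?v = B u u / (?s * ?s)"
      unfolding B_def by (simp add: sum_divide_distrib sum_distrib_left field_simps cong: sum.cong)
    also have "\<dots> = B u u / P u u" using True by simp
    finally have "B u u / P u u \<le> \<mu>" using max[OF normalize[OF u True]] by (simp add: \<mu>_def)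
    thus ?thesis using True by (simp add: pos_divide_le_eq)
  next
    case False
    hence "u x = 0" if "x \<in> V" for x using pos[OF that, of u] by auto
    thus ?thesis by (simp add: B_def P_def)
  qed
  define M where "M x = (\<Sum>y\<in>V. a x y * f y)" for x
  \<comment> \<open>The residual of the eigenvalue equation, used as the direction of
    perturbation.\<close>
  define g where "g x = M x - \<mu> * f x" for x
  have "(\<Sum>x\<in>V. M x) = (\<Sum>y\<in>V. (\<Sum>x\<in>V. a x y) * f y)"
    unfolding M_def sum_distrib_right by (rule sum.swap)
  also have "\<dots> = (\<Sum>y\<in>V. c * f y)"
  proof (intro sum.cong refl)
    fix y assume y: "y \<in> V"
    have "(\<Sum>x\<in>V. a x y) = (\<Sum>x\<in>V. a y x)" using sym y by (intro sum.cong) auto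
    thus "(\<Sum>x\<in>V. a x y) * f y = c * f y" using row[OF y] by simp
  qed
  also have "\<dots> = 0" using f0 by (simp flip: sum_distrib_left)
  finally have g0: "(\<Sum>x\<in>V. g x) = 0"
    using f0 by (simp add: g_def sum_subtractf flip: sum_distrib_left)
  have symB: "B f g = B g f"
  proof -
    have "B f g = (\<Sum>x\<in>V. \<Sum>y\<in>V. f x * a x y * g y)"
      by (simp add: B_def sum_distrib_left mult.assoc)
    also have "\<dots> = (\<Sum>y\<in>V. \<Sum>x\<in>V. f x * a x y * g y)" by (rule sum.swap)
    also have "\<dots> = (\<Sum>y\<in>V. \<Sum>x\<in>V. g y * (a y x * f x))"
      by (intro sum.cong refl) (simp add: sym mult.commute mult.left_commute)
    finally show ?thesis by (simp add: B_def sum_distrib_left)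
  qed
  \<comment> \<open>Maximality at \<open>f + t * g\<close>, expanded; the terms of order 0 cancel
    because \<open>B f f = \<mu>\<close> and \<open>P f f = 1\<close>.\<close>
  have "2 * (B g f - \<mu> * P g f) * t \<le> (\<mu> * P g g - B g g) * t\<^sup>2" for t
  proof -
    let ?u = "\<lambda>x. f x + t * g x"
    have "(\<Sum>x\<in>V. ?u x) = 0" using f0 g0 by (simp add: sum.distrib flip: sum_distrib_left)
    hence "B ?u ?u \<le> \<mu> * P ?u ?u" by (rule le)
    moreover have "B ?u ?u = B f f + t * B f g + t * B g f + t\<^sup>2 * B g g"
      unfolding B_def
      by (simp add: algebra_simps sum.distrib sum_distrib_left power2_eq_square)
    moreover have "P ?u ?u = P f f + 2 * t * P g f + t\<^sup>2 * P g g"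
      unfolding P_def
      by (simp add: algebra_simps sum.distrib sum_distrib_left power2_eq_square)
    ultimately show ?thesis using symB ff by (simp add: \<mu>_def algebra_simps)
  qed
  hence "B g f - \<mu> * P g f = 0" using linear_coeff_zero by fastforce
  \<comment> \<open>Up to the factor 2, the vanishing linear coefficient is the squared norm of
    \<open>g\<close>.\<close>
  moreover have "B g f - \<mu> * P g f = P g g"
    by (simp add: B_def P_def g_def right_diff_distrib sum_subtractf sum_distrib_left
          mult.left_commute flip: M_def)
  ultimately have "P g g = 0" by simp
  hence g: "g x = 0" if "x \<in> V" for x using pos[OF that, of g] by auto
  show thesis
  proof (rule that)
    show "\<exists>x\<in>V. f x \<noteq> 0" using ff by (rule contrapos_pp) (simp add: P_def)
    show "(\<Sum>y\<in>V. a x y * f y) = \<mu> * f x" if "x \<in> V" for x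
      using g[OF that] by (simp add: g_def M_def)
    show "(\<Sum>x\<in>V. u x * (\<Sum>y\<in>V. a x y * u y)) \<le> \<mu> * (\<Sum>x\<in>V. (u x)\<^sup>2)"
      if "(\<Sum>x\<in>V. u x) = 0" for u
      using le[OF that] by (simp add: B_def P_def power2_eq_square)
  qed (rule f0)
qed

section \<open>Two independent eigenvectors and the characteristic polynomial\<close>

lemma sum_const_poly: "(\<Sum>x\<in>A. [:f x:]) = [:\<Sum>x\<in>A. f x:]"
  by (induction A rule: infinite_finite_induct) auto

lemma char_poly_matrix_mult_const:
  fixes A :: "'a :: comm_ring_1 mat"
  assumes A: "A \<in> carrier_mat n n" and v: "v \<in> carrier_vec n" and Av: "A *\<^sub>v v = \<kappa> \<cdot>\<^sub>v v"
  shows "char_poly_matrix A *\<^sub>v map_vec (\<lambda>c. [:c:]) v = [:-\<kappa>, 1:] \<cdot>\<^sub>v map_vec (\<lambda>c. [:c:]) v"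
proof (rule eq_vecI)
  fix i assume "i < dim_vec ([:-\<kappa>, 1:] \<cdot>\<^sub>v map_vec (\<lambda>c. [:c:]) v)"
  hence i: "i < n" using v by auto
  have "(\<Sum>j = 0..<n. A $$ (i, j) * v $ j) = (A *\<^sub>v v) $ i"
    using A v i by (auto simp: scalar_prod_def)
  also have "\<dots> = \<kappa> * v $ i" using Av v i by simp
  finally have sum: "(\<Sum>j = 0..<n. A $$ (i, j) * v $ j) = \<kappa> * v $ i" .
  have "(char_poly_matrix A *\<^sub>v map_vec (\<lambda>c. [:c:]) v) $ i =
      (\<Sum>j = 0..<n. (if i = j then [:0, v $ j:] else 0) - [:A $$ (i, j) * v $ j:])"
    using A v i by (auto simp: char_poly_matrix_def scalar_prod_def intro!: sum.cong)
  also have "\<dots> = [:0, v $ i:] - [:\<kappa> * v $ i:]"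
    using i by (simp add: sum_subtractf sum_const_poly sum)
  finally show "(char_poly_matrix A *\<^sub>v map_vec (\<lambda>c. [:c:]) v) $ i =
      ([:-\<kappa>, 1:] \<cdot>\<^sub>v map_vec (\<lambda>c. [:c:]) v) $ i" using v i by (simp add: mult.commute)
qed (use A v in \<open>auto simp: char_poly_matrix_def\<close>)

lemma det_replace_col_smult:
  fixes A :: "'a :: comm_ring_1 mat"
  assumes "A \<in> carrier_mat n n" "v \<in> carrier_vec n" "k < n"
  shows "det (replace_col A (c \<cdot>\<^sub>v v) k) = c * det (replace_col A v k)"
proof -
  have R: "replace_col A v k \<in> carrier_mat n n" using assms by (auto simp: replace_col_def)
  have "replace_col A (c \<cdot>\<^sub>v v) k = multcol k c (replace_col A v k)"
    using assms by (intro eq_matI) (auto simp: replace_col_def)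
  also have "det \<dots> = det (replace_col A v k) * det (multrow_mat n k c)"
    using det_mult[OF R] by (simp add: multcol_mat[OF R])
  finally show ?thesis using assms(3) by (simp add: det_multrow_mat mult.commute)
qed

text \<open>Cramer's rule is used twice over the polynomial ring: replacing column \<open>i\<close>
  of the characteristic matrix by \<open>v\<close> splits off the first factor, and replacing column
  \<open>k\<close> of the result splits off the second. The inequality in \<open>ik\<close> is a
  nonzero 2 by 2 minor, so \<open>v\<close> and \<open>w\<close> are independent and even
  \<open>\<kappa> = \<mu>\<close> yields a double factor.\<close>

lemma char_poly_dvd_two_eigenvectors:
  fixes A :: "'a :: field mat"
  assumes A: "A \<in> carrier_mat n n"
    and v: "v \<in> carrier_vec n" "A *\<^sub>v v = \<kappa> \<cdot>\<^sub>v v"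
    and w: "w \<in> carrier_vec n" "A *\<^sub>v w = \<mu> \<cdot>\<^sub>v w"
    and ik: "i < n" "k < n" "v $ i \<noteq> 0" "v $ i * w $ k \<noteq> w $ i * v $ k"
  shows "[:-\<kappa>, 1:] * [:-\<mu>, 1:] dvd char_poly A"
proof -
  define C where "C = char_poly_matrix A"
  define p :: "'a vec \<Rightarrow> 'a poly vec" where "p = map_vec (\<lambda>c. [:c:])"
  have C: "C \<in> carrier_mat n n" using A by (simp add: C_def)
  have pc: "p u \<in> carrier_vec n" if "u \<in> carrier_vec n" for u using that by (simp add: p_def)
  have Cv: "C *\<^sub>v p v = [:-\<kappa>, 1:] \<cdot>\<^sub>v p v" and Cw: "C *\<^sub>v p w = [:-\<mu>, 1:] \<cdot>\<^sub>v p w"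
    using char_poly_matrix_mult_const A v w by (auto simp: C_def p_def)
  define C' where "C' = replace_col C (p v) i"
  have C': "C' \<in> carrier_mat n n" using C by (auto simp: C'_def replace_col_def)
  have 1: "[:-\<kappa>, 1:] * det C' = [:v $ i:] * det C"
  proof -
    have "[:-\<kappa>, 1:] * det C' = det (replace_col C (C *\<^sub>v p v) i)"
      unfolding Cv C'_def by (rule det_replace_col_smult[OF C pc[OF v(1)] ik(1), symmetric])
    also have "\<dots> = p v $ i * det C" by (rule cramer_lemma_mat[OF C pc[OF v(1)] ik(1)])
    finally show ?thesis using v(1) ik(1) by (simp add: p_def)
  qed
  \<comment> \<open>\<open>g\<close> vanishes at \<open>i\<close>, so it does not see the replaced
    column. The multiple of the unit vector in \<open>h\<close> adds
    \<open>w $ i * (\<mu> - \<kappa>)\<close> times \<open>v\<close>, which changes the factor at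
    \<open>v\<close> from the one of \<open>\<kappa>\<close> to the one of
    \<open>\<mu>\<close>.\<close>
  define g where "g = v $ i \<cdot>\<^sub>v w - w $ i \<cdot>\<^sub>v v"
  define h where "h = g + (w $ i * (\<mu> - \<kappa>)) \<cdot>\<^sub>v unit_vec n i"
  have g: "g \<in> carrier_vec n" and h: "h \<in> carrier_vec n" using v w by (auto simp: g_def h_def)
  have "C' *\<^sub>v p h = [:-\<mu>, 1:] \<cdot>\<^sub>v p g"
  proof (rule eq_vecI)
    fix r assume "r < dim_vec ([:-\<mu>, 1:] \<cdot>\<^sub>v p g)"
    hence r: "r < n" using g by (auto simp: p_def)
    have row: "(\<Sum>j = 0..<n. C $$ (r, j) * [:u $ j:]) = (C *\<^sub>v p u) $ r" if "u \<in> carrier_vec n" for u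
      using that C r by (simp add: scalar_prod_def p_def)
    have "(C' *\<^sub>v p h) $ r = (\<Sum>j = 0..<n. C' $$ (r, j) * [:h $ j:])"
      using C' r h by (simp add: scalar_prod_def p_def)
    also have "\<dots> = (\<Sum>j = 0..<n. ([:v $ i:] * (C $$ (r, j) * [:w $ j:]) - [:w $ i:] * (C $$ (r, j) * [:v $ j:]))
        + (if j = i then [:w $ i * (\<mu> - \<kappa>):] * [:v $ r:] else 0))"
    proof (intro sum.cong refl)
      fix j assume "j \<in> {0..<n}"
      thus "C' $$ (r, j) * [:h $ j:] = ([:v $ i:] * (C $$ (r, j) * [:w $ j:]) - [:w $ i:] * (C $$ (r, j) * [:v $ j:]))
        + (if j = i then [:w $ i * (\<mu> - \<kappa>):] * [:v $ r:] else 0)"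
        using C r v(1) w(1) ik(1) by (cases "j = i") (auto simp: C'_def replace_col_def h_def g_def p_def algebra_simps
          smult_diff_right smult_diff_left simp flip: diff_pCons)
    qed
    also have "\<dots> = [:v $ i:] * (C *\<^sub>v p w) $ r - [:w $ i:] * (C *\<^sub>v p v) $ r + [:w $ i * (\<mu> - \<kappa>):] * [:v $ r:]"
      using ik(1) by (simp only: sum.distrib sum_subtractf sum_distrib_left[symmetric] row v(1) w(1)
        sum.delta finite_atLeastLessThan atLeastLessThan_iff le0 simp_thms if_True)
    also have "\<dots> = ([:-\<mu>, 1:] \<cdot>\<^sub>v p g) $ r"
      unfolding Cv Cw using v(1) w(1) g r by (auto simp: p_def g_def algebra_simps)
    finally show "(C' *\<^sub>v p h) $ r = ([:-\<mu>, 1:] \<cdot>\<^sub>v p g) $ r" .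
  qed (use C' g in \<open>auto simp: p_def\<close>)
  moreover have "i \<noteq> k" using ik by auto
  hence "h $ k = g $ k" using ik v w by (simp add: h_def g_def)
  ultimately have "[:-\<mu>, 1:] * det (replace_col C' (p g) k) = [:g $ k:] * det C'"
    using cramer_lemma_mat[OF C' pc[OF h] ik(2)] det_replace_col_smult[OF C' pc[OF g] ik(2)]
      h ik(2) by (simp add: p_def del: mult_pCons_left)
  also have "\<dots> = smult (g $ k) (det C')" by simp
  finally have "[:-\<mu>, 1:] dvd smult (g $ k) (det C')" by (rule dvdI[OF sym])
  moreover have "g $ k \<noteq> 0" using ik v w by (simp add: g_def)
  ultimately have "[:-\<mu>, 1:] dvd det C'" using dvd_smult_iff by blast
  hence "[:-\<kappa>, 1:] * [:-\<mu>, 1:] dvd [:-\<kappa>, 1:] * det C'" by (intro mult_dvd_mono) auto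
  also have "\<dots> = smult (v $ i) (char_poly A)" unfolding 1 by (simp add: C_def char_poly_def)
  finally show ?thesis using ik(3) by (simp add: dvd_smult_iff)
qed

text \<open>If position 1 of the descending list were below both, only its head could reach
  \<open>min a b\<close>, whereas \<open>M\<close> contains two such entries. Multiset inclusion
  also covers \<open>a = b\<close>.\<close>

lemma nth_one_rev_sorted_list_of_multiset_ge:
  fixes M :: "'a :: linorder multiset"
  assumes "{#a, b#} \<subseteq># M"
  shows "rev (sorted_list_of_multiset M) ! 1 \<ge> min a b"
proof (rule ccontr)
  define xs where "xs = rev (sorted_list_of_multiset M)"
  assume "\<not> rev (sorted_list_of_multiset M) ! 1 \<ge> min a b"
  hence lt: "xs ! 1 < min a b" unfolding xs_def not_le .
  have mset: "mset xs = M" by (simp add: xs_def)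
  have srt: "sorted (rev xs)" by (simp add: xs_def)
  have "size {#a, b#} \<le> size M" using assms by (rule size_mset_mono)
  hence len: "length xs \<ge> 2" by (simp flip: mset)
  then obtain x y ys where xs: "xs = x # y # ys" by (cases xs; cases "tl xs") auto
  have "z \<le> y" if "z \<in> set ys" for z using srt that by (auto simp: xs sorted_append)
  hence "z < min a b" if "z \<in> set (y # ys)" for z
    using that lt le_less_trans[of z y "min a b"] by (auto simp: xs simp del: min_less_iff_conj)
  hence "filter (\<lambda>z. z \<ge> min a b) (y # ys) = []" unfolding filter_empty_conv not_le by blast
  hence "mset (filter (\<lambda>z. z \<ge> min a b) xs) \<subseteq># {#x#}" by (simp add: xs)
  hence "filter_mset (\<lambda>z. z \<ge> min a b) M \<subseteq># {#x#}" by (simp flip: mset)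
  moreover have "filter_mset (\<lambda>z. z \<ge> min a b) {#a, b#} \<subseteq># filter_mset (\<lambda>z. z \<ge> min a b) M"
    using assms by (rule multiset_filter_mono)
  ultimately have "{#a, b#} \<subseteq># {#x#}" by (auto dest: subset_mset.order_trans)
  thus False using size_mset_mono by fastforce
qed

section \<open>The averaging operator and its Rayleigh quotients\<close>

lemma sum_image_mset_eq_sum_count:
  fixes f :: "'a \<Rightarrow> 'b :: semiring_1"
  assumes "finite V" "set_mset M \<subseteq> V"
  shows "(\<Sum>y\<in>#M. f y) = (\<Sum>y\<in>V. of_nat (count M y) * f y)"
  using assms(2)
proof (induction M)
  case (add x M)
  hence "x \<in> V" by simp
  have "(\<Sum>y\<in>V. of_nat (count (add_mset x M) y) * f y) =
      (\<Sum>y\<in>V. of_nat (count M y) * f y + (if y = x then f x else 0))"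
    by (intro sum.cong) (auto simp: algebra_simps)
  thus ?case using add assms(1) \<open>x \<in> V\<close> by (simp add: sum.distrib add.commute)
qed simp

lemma averaging_op_eq_sum:
  assumes "regular_graph d \<Gamma>" "x \<in> vertices \<Gamma>"
  shows "averaging_op \<Gamma> v x = (\<Sum>y\<in>vertices \<Gamma>. real (count (nbrs \<Gamma> x) y) / real d * v y)"
proof -
  have "finite (vertices \<Gamma>)" "set_mset (nbrs \<Gamma> x) \<subseteq> vertices \<Gamma>" "size (nbrs \<Gamma> x) = d"
    using assms by (auto simp: regular_graph_def)
  thus ?thesis
    by (simp add: averaging_op_def sum_image_mset_eq_sum_count sum_divide_distrib)
qed

text \<open>Constants have eigenvalue 1 and the maximal mean-zero eigenfunction has eigenvalue
  \<open>\<mu>\<close>. Both count in the spectrum, so \<open>min 1 \<mu>\<close> is at most the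
  second eigenvalue; as that is below 1, the gap bounds \<open>\<mu>\<close> and with it every
  mean-zero Rayleigh quotient.\<close>

lemma mean_zero_rayleigh_le:
  assumes reg: "regular_graph d \<Gamma>" and d: "d > 0" and card: "card (vertices \<Gamma>) \<ge> 2"
    and \<epsilon>: "\<epsilon> > 0" "gap \<Gamma> \<ge> \<epsilon>" and u: "(\<Sum>x\<in>vertices \<Gamma>. u x) = 0"
  shows "(\<Sum>x\<in>vertices \<Gamma>. u x * averaging_op \<Gamma> u x) \<le> (1 - \<epsilon>) * (\<Sum>x\<in>vertices \<Gamma>. (u x)\<^sup>2)"
proof -
  define V where "V = vertices \<Gamma>"
  define a where "a x y = real (count (nbrs \<Gamma> x) y) / real d" for x y
  have avg: "averaging_op \<Gamma> v x = (\<Sum>y\<in>V. a x y * v y)" if "x \<in> V" for v x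
    using averaging_op_eq_sum[OF reg] that by (simp add: a_def V_def)
  have V: "finite V" using reg by (simp add: regular_graph_def V_def)
  have sym: "a x y = a y x" if "x \<in> V" "y \<in> V" for x y
    using reg that by (simp add: regular_graph_def a_def V_def)
  have row: "(\<Sum>y\<in>V. a x y) = 1" if "x \<in> V" for x
  proof -
    have "size (nbrs \<Gamma> x) = d" using reg that by (simp add: regular_graph_def V_def)
    hence "averaging_op \<Gamma> (\<lambda>_. 1) x = 1" using d by (simp add: averaging_op_def)
    thus ?thesis using avg[OF that, of "\<lambda>_. 1"] by simp
  qed
  obtain x0 y0 where xy0: "x0 \<in> V" "y0 \<in> V" "x0 \<noteq> y0"
    using card card_le_Suc0_iff_eq[OF V] by (fastforce simp: V_def)
  define u0 :: "'a \<Rightarrow> real" where "u0 x = of_bool (x = x0) - of_bool (x = y0)" for x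
  have u0: "(\<Sum>x\<in>V. u0 x) = 0" "u0 x0 \<noteq> 0"
    using xy0 V by (auto simp: u0_def sum_subtractf of_bool_def)
  obtain f \<mu> where f: "(\<Sum>x\<in>V. f x) = 0" "\<exists>x\<in>V. f x \<noteq> 0"
    and eig: "\<And>x. x \<in> V \<Longrightarrow> (\<Sum>y\<in>V. a x y * f y) = \<mu> * f x"
    and le: "\<And>u. (\<Sum>x\<in>V. u x) = 0 \<Longrightarrow> (\<Sum>x\<in>V. u x * (\<Sum>y\<in>V. a x y * u y)) \<le> \<mu> * (\<Sum>x\<in>V. (u x)\<^sup>2)"
    by (rule ex_max_rayleigh_mean_zero[where a = a, OF V sym row u0(1) xy0(1) u0(2)]) (use that sym row in blast)+
  \<comment> \<open>A nonzero mean-zero function is not constant; two points with different values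
    give a nonzero minor with the constant vector.\<close>
  have "\<exists>x1\<in>V. \<exists>y1\<in>V. f x1 \<noteq> f y1"
  proof (rule ccontr)
    assume "\<not> ?thesis"
    hence const: "f x = f x0" if "x \<in> V" for x using that xy0(1) by blast
    have "(\<Sum>x\<in>V. f x) = (\<Sum>x\<in>V. f x0)" by (rule sum.cong[OF refl const])
    hence "real (card V) * f x0 = 0" using f(1) by simp
    hence "f x0 = 0" using card by (simp add: V_def)
    thus False using f(2) const by metis
  qed
  then obtain x1 y1 where xy1: "x1 \<in> V" "y1 \<in> V" "f x1 \<noteq> f y1" by blast
  obtain ys where ys: "distinct ys" "set ys = V" using finite_distinct_list[OF V] by blast
  define n where "n = length ys"
  define A where "A = averaging_mat \<Gamma> ys"
  have A: "A \<in> carrier_mat n n" by (simp add: A_def averaging_mat_def n_def)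
  have inV: "ys ! i \<in> V" if "i < n" for i using that ys by (auto simp: n_def)
  have A_ij: "A $$ (i, j) = a (ys ! i) (ys ! j)" if "i < n" "j < n" for i j
    using that inV V by (simp add: A_def averaging_mat_def n_def avg of_bool_def
        if_distrib[of "(*) _"] cong: if_cong)
  have Av: "A *\<^sub>v vec n (\<lambda>i. g (ys ! i)) = c \<cdot>\<^sub>v vec n (\<lambda>i. g (ys ! i))"
    if g: "\<And>x. x \<in> V \<Longrightarrow> (\<Sum>y\<in>V. a x y * g y) = c * g x" for g c
  proof (rule eq_vecI)
    fix i assume "i < dim_vec (c \<cdot>\<^sub>v vec n (\<lambda>i. g (ys ! i)))"
    hence i: "i < n" by simp
    have "(A *\<^sub>v vec n (\<lambda>i. g (ys ! i))) $ i = (\<Sum>j = 0..<n. a (ys ! i) (ys ! j) * g (ys ! j))"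
      using A i by (simp add: scalar_prod_def A_ij)
    also have "\<dots> = (\<Sum>y\<in>V. a (ys ! i) y * g y)"
      using sum.reindex_bij_betw[OF bij_betw_nth[OF ys(1), of "{0..<n}" V], of "\<lambda>y. a (ys ! i) y * g y"] ys
      by (simp add: n_def atLeast0LessThan)
    finally show "(A *\<^sub>v vec n (\<lambda>i. g (ys ! i))) $ i = (c \<cdot>\<^sub>v vec n (\<lambda>i. g (ys ! i))) $ i"
      using i by (simp add: g[OF inV[OF i]])
  qed (use A in auto)
  obtain i k where ik: "i < n" "k < n" "ys ! i = x1" "ys ! k = y1"
    using xy1 ys unfolding n_def by (metis in_set_conv_nth)
  have "[:-1, 1:] * [:-\<mu>, 1:] dvd char_poly A"
  proof (rule char_poly_dvd_two_eigenvectors[OF A, where i = i and k = k])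
    show "A *\<^sub>v vec n (\<lambda>i. 1) = 1 \<cdot>\<^sub>v vec n (\<lambda>i. 1)"
      by (rule Av) (simp add: row)
    show "A *\<^sub>v vec n (\<lambda>i. f (ys ! i)) = \<mu> \<cdot>\<^sub>v vec n (\<lambda>i. f (ys ! i))"
      by (rule Av) (rule eig)
  qed (use ik xy1 in simp_all)
  then obtain q where q: "char_poly A = [:-1, 1:] * [:-\<mu>, 1:] * q" by blast
  have "char_poly A \<noteq> 0" using degree_monic_char_poly[OF A] by auto
  \<comment> \<open>\<open>proots\<close> counts multiplicities, so both roots remain even if
    \<open>\<mu> = 1\<close>.\<close>
  hence "proots (char_poly A) = {#1, \<mu>#} + proots q"
    unfolding q by (simp add: proots_mult del: mult_pCons_left mult_pCons_right)
  hence "min 1 \<mu> \<le> eigenvalue_list \<Gamma> ! 1"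
    unfolding eigenvalue_list_def averaging_char_poly_eq[OF ys[unfolded V_def]] A_def[symmetric]
    by (intro nth_one_rev_sorted_list_of_multiset_ge) simp
  hence "\<mu> \<le> 1 - \<epsilon>" using \<epsilon> by (simp add: gap_def)
  hence "\<mu> * (\<Sum>x\<in>V. (u x)\<^sup>2) \<le> (1 - \<epsilon>) * (\<Sum>x\<in>V. (u x)\<^sup>2)"
    by (intro mult_right_mono sum_nonneg) auto
  thus ?thesis using le[of u] u avg by (simp add: V_def)
qed

section \<open>Test functions that limit large gaps\<close>

lemma rayleigh_point_difference:
  assumes reg: "regular_graph d \<Gamma>" and d: "d > 0" and \<epsilon>: "\<epsilon> > 0" "gap \<Gamma> \<ge> \<epsilon>"
    and xy: "x \<in> vertices \<Gamma>" "y \<in> vertices \<Gamma>" "x \<noteq> y"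
  shows "real (count (nbrs \<Gamma> x) x) + real (count (nbrs \<Gamma> y) y) - 2 * real (count (nbrs \<Gamma> x) y)
    \<le> 2 * real d * (1 - \<epsilon>)"
proof -
  define V where "V = vertices \<Gamma>"
  have V: "finite V" "x \<in> V" "y \<in> V" using reg xy by (auto simp: regular_graph_def V_def)
  have sym: "count (nbrs \<Gamma> y) x = count (nbrs \<Gamma> x) y" using reg xy by (simp add: regular_graph_def)
  have card: "card V \<ge> 2" using card_mono[of V "{x, y}"] V xy(3) by simp
  \<comment> \<open>A difference of two point masses: its quadratic form sees only the loops at
    \<open>x\<close> and \<open>y\<close> and the edges joining them.\<close>
  define u where "u z = (if z = x then 1 else 0) - (if z = y then 1 else 0 :: real)" for z
  have pick: "(\<Sum>z\<in>V. u z * f z) = f x - f y" for f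
  proof -
    have "(\<Sum>z\<in>V. u z * f z) = (\<Sum>z\<in>V. (if z = x then f z else 0) - (if z = y then f z else 0))"
      by (intro sum.cong) (auto simp: u_def)
    thus ?thesis using V by (simp add: sum_subtractf)
  qed
  have "averaging_op \<Gamma> u z = (real (count (nbrs \<Gamma> z) x) - real (count (nbrs \<Gamma> z) y)) / d" if "z \<in> V" for z
    using averaging_op_eq_sum[OF reg, of z u] that pick[of "\<lambda>y. real (count (nbrs \<Gamma> z) y) / d"]
    by (simp add: V_def mult.commute diff_divide_distrib)
  hence "(\<Sum>z\<in>V. u z * averaging_op \<Gamma> u z) =
      (real (count (nbrs \<Gamma> x) x) + real (count (nbrs \<Gamma> y) y) - 2 * real (count (nbrs \<Gamma> x) y)) / d"
    using V by (simp add: pick sym diff_divide_distrib add_divide_distrib)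
  moreover have "(\<Sum>z\<in>V. (u z)\<^sup>2) = 2" using pick[of u] xy(3) by (simp add: u_def power2_eq_square)
  moreover have "(\<Sum>z\<in>V. u z) = 0" using pick[of "\<lambda>_. 1"] by simp
  ultimately have "(real (count (nbrs \<Gamma> x) x) + real (count (nbrs \<Gamma> y) y) - 2 * real (count (nbrs \<Gamma> x) y)) / d
      \<le> (1 - \<epsilon>) * 2"
    using mean_zero_rayleigh_le[OF reg d _ \<epsilon>, of u] card unfolding V_def by simp
  thus ?thesis using d by (simp add: pos_divide_le_eq mult.commute mult.left_commute)
qed

text \<open>For \<open>\<epsilon> > 1\<close> every difference of two point masses has a negative
  quadratic form, which forces an edge between any two distinct vertices.\<close>

lemma card_vertices_le_Suc_degree:
  assumes reg: "regular_graph d \<Gamma>" and d: "d > 0" and \<epsilon>: "\<epsilon> > 1" "gap \<Gamma> \<ge> \<epsilon>"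
  shows "card (vertices \<Gamma>) \<le> Suc d"
proof (cases "vertices \<Gamma> = {}")
  case False
  then obtain x where x: "x \<in> vertices \<Gamma>" by blast
  have V: "finite (vertices \<Gamma>)" "size (nbrs \<Gamma> x) = d" using reg x by (auto simp: regular_graph_def)
  have "vertices \<Gamma> - {x} \<subseteq> set_mset (nbrs \<Gamma> x)"
  proof
    fix y assume y: "y \<in> vertices \<Gamma> - {x}"
    have "2 * real d * (1 - \<epsilon>) < 0" using \<epsilon> d by (simp add: mult_less_0_iff)
    moreover have "real (count (nbrs \<Gamma> x) x) + real (count (nbrs \<Gamma> y) y) - 2 * real (count (nbrs \<Gamma> x) y)
        \<le> 2 * real d * (1 - \<epsilon>)"
      using rayleigh_point_difference[OF reg d _ \<epsilon>(2) x, of y] y \<epsilon>(1) by auto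
    ultimately have "count (nbrs \<Gamma> x) y \<noteq> 0" by (intro notI) simp
    thus "y \<in># nbrs \<Gamma> x" by (simp add: count_eq_zero_iff)
  qed
  hence "card (vertices \<Gamma> - {x}) \<le> card (set_mset (nbrs \<Gamma> x))" by (intro card_mono) auto
  also have "\<dots> \<le> d"
    using size_mset_mono[OF mset_set_set_mset_msubset[of "nbrs \<Gamma> x"]] V(2) by simp
  finally show ?thesis using V(1) x by (simp add: card_Diff_singleton)
qed simp

text \<open>The gap is at most \<open>n / (n - 1)\<close>, its value for a complete graph. The test
  function is \<open>n\<close> times a point mass minus 1: its quadratic form is at least
  \<open>- n\<close>, since loops contribute nonnegatively, and its squared norm is
  \<open>n * (n - 1)\<close>.\<close>

lemma gap_le:
  assumes reg: "regular_graph d \<Gamma>" and d: "d > 0" and card: "card (vertices \<Gamma>) \<ge> 2"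
    and \<epsilon>: "\<epsilon> > 0" "gap \<Gamma> \<ge> \<epsilon>"
  shows "(\<epsilon> - 1) * (real (card (vertices \<Gamma>)) - 1) \<le> 1"
proof -
  define V where "V = vertices \<Gamma>"
  define n where "n = real (card V)"
  have "V \<noteq> {}" using card by (auto simp: V_def)
  then obtain x where x: "x \<in> V" by blast
  have V: "finite V" using reg by (auto simp: regular_graph_def V_def)
  have sym: "count (nbrs \<Gamma> y) x = count (nbrs \<Gamma> x) y" if "y \<in> V" for y
    using reg x that by (simp add: regular_graph_def V_def)
  define a where "a y z = real (count (nbrs \<Gamma> y) z) / d" for y z
  have avg: "averaging_op \<Gamma> v y = (\<Sum>z\<in>V. a y z * v z)" if "y \<in> V" for v y
    using averaging_op_eq_sum[OF reg] that by (simp add: a_def V_def)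
  have row: "(\<Sum>z\<in>V. a y z) = 1" if "y \<in> V" for y
  proof -
    have "size (nbrs \<Gamma> y) = d" using reg that by (simp add: regular_graph_def V_def)
    hence "averaging_op \<Gamma> (\<lambda>_. 1) y = 1" using d by (simp add: averaging_op_def)
    thus ?thesis using avg[OF that, of "\<lambda>_. 1"] by simp
  qed
  define u where "u z = (if z = x then n else 0) - 1" for z
  have pick: "(\<Sum>z\<in>V. u z * f z) = n * f x - (\<Sum>z\<in>V. f z)" for f
  proof -
    have "(\<Sum>z\<in>V. u z * f z) = (\<Sum>z\<in>V. (if z = x then n * f z else 0) - f z)"
      by (intro sum.cong) (auto simp: u_def left_diff_distrib)
    thus ?thesis using V x by (simp add: sum_subtractf)
  qed
  have avg_u: "averaging_op \<Gamma> u z = n * a z x - 1" if "z \<in> V" for z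
    using avg[OF that, of u] pick[of "a z"] row[OF that] by (simp add: mult.commute)
  have "(\<Sum>z\<in>V. u z * averaging_op \<Gamma> u z) = n * (n * a x x - 1) - (\<Sum>z\<in>V. n * a z x - 1)"
    using x by (simp add: pick avg_u)
  \<comment> \<open>By symmetry the columns of \<open>a\<close> sum to 1 as well.\<close>
  also have "(\<Sum>z\<in>V. n * a z x - 1) = 0"
  proof -
    have "(\<Sum>z\<in>V. a z x) = (\<Sum>z\<in>V. a x z)" using sym by (intro sum.cong) (auto simp: a_def)
    thus ?thesis using row[OF x] by (simp add: sum_subtractf n_def flip: sum_distrib_left)
  qed
  finally have Q: "(\<Sum>z\<in>V. u z * averaging_op \<Gamma> u z) \<ge> - n"
    by (simp add: a_def n_def right_diff_distrib)
  have u0: "(\<Sum>z\<in>V. u z) = 0" using pick[of "\<lambda>_. 1"] by (simp add: n_def)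
  have "(\<Sum>z\<in>V. (u z)\<^sup>2) = n * (n - 1)"
    using pick[of u] u0 by (simp add: u_def power2_eq_square)
  hence "- n \<le> (1 - \<epsilon>) * (n * (n - 1))"
    using Q mean_zero_rayleigh_le[OF reg d card \<epsilon>, of u] u0 unfolding V_def by simp
  hence "n * ((\<epsilon> - 1) * (n - 1)) \<le> n * 1" by (simp add: algebra_simps)
  moreover have "n > 0" using card by (simp add: n_def V_def)
  ultimately show ?thesis by (simp add: n_def V_def)
qed

section \<open>Characters of finite abelian groups\<close>

text \<open>A homomorphism to the unit circle. Fixing the value off \<open>B\<close> makes two
  characters equal as functions exactly when they agree on \<open>B\<close>, so that they can be
  counted.\<close>

definition unit_character :: "('a, 'b) monoid_scheme \<Rightarrow> 'a set \<Rightarrow> ('a \<Rightarrow> complex) \<Rightarrow> bool" where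
  "unit_character G B \<chi> \<longleftrightarrow> \<chi> \<in> extensional B \<and> (\<forall>x\<in>B. cmod (\<chi> x) = 1) \<and>
     (\<forall>x\<in>B. \<forall>y\<in>B. \<chi> (x \<otimes>\<^bsub>G\<^esub> y) = \<chi> x * \<chi> y)"

context comm_group begin

lemma unit_character_one:
  assumes "subgroup B G" "unit_character G B \<chi>"
  shows "\<chi> \<one> = 1"
proof -
  have B: "\<one> \<in> B" using assms(1) by (rule subgroup.one_closed)
  have "\<chi> (\<one> \<otimes> \<one>) = \<chi> \<one> * \<chi> \<one>" "cmod (\<chi> \<one>) = 1"
    using B assms(2) unfolding unit_character_def by blast+
  thus ?thesis by auto
qed

lemma unit_character_pow:
  assumes "subgroup B G" "unit_character G B \<chi>" "x \<in> B"
  shows "\<chi> (x [^] (n::nat)) = \<chi> x ^ n"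
proof (induction n)
  case 0
  thus ?case using unit_character_one[OF assms(1,2)] by simp
next
  case (Suc n)
  have "x [^] n \<in> B"
    by (induction n) (use assms in \<open>auto intro: subgroup.one_closed subgroup.m_closed\<close>)
  thus ?case using Suc assms by (simp add: unit_character_def)
qed

text \<open>If \<open>k\<close> is the order of \<open>g\<close> modulo \<open>B\<close>, each
  character of \<open>B\<close> extends in \<open>k\<close> ways, one for each \<open>k\<close>-th
  root of its value at \<open>g [^] k\<close>, while the subgroup grows by a factor of at most
  \<open>k\<close>.\<close>

lemma extend_unit_characters:
  assumes fin: "finite (carrier G)" and B: "subgroup B G" and g: "g \<in> carrier G" "g \<notin> B"
    and X: "finite F" "card F \<ge> card B" "\<forall>\<chi>\<in>F. unit_character G B \<chi>"
  obtains C F' where "subgroup C G" "B \<subset> C" "finite F'" "card F' \<ge> card C" "\<forall>\<chi>\<in>F'. unit_character G C \<chi>"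
proof -
  have BG: "b \<in> carrier G" if "b \<in> B" for b using B that by (rule subgroup.mem_carrier)
  note Bm = subgroup.m_closed[OF B] and Bi = subgroup.m_inv_closed[OF B] and B1 = subgroup.one_closed[OF B]
  have Bpow: "b [^] (n::nat) \<in> B" if "b \<in> B" for b n
    by (induction n) (use that Bm B1 in auto)
  define k where "k = (LEAST k::nat. k > 0 \<and> g [^] k \<in> B)"
  have "Coset.order G > 0" using fin by (simp add: order_gt_0_iff_finite)
  hence "\<exists>k::nat. k > 0 \<and> g [^] k \<in> B" using pow_order_eq_1[OF g(1)] B1 by metis
  hence k: "k > 0" "g [^] k \<in> B" unfolding k_def by (metis (mono_tags, lifting) LeastI)+
  have kmin: "g [^] j \<notin> B" if "0 < j" "j < k" for j
    using that not_less_Least unfolding k_def by blast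
  have kdvd: "k dvd j" if j: "g [^] j \<in> B" for j
  proof (rule ccontr)
    assume "\<not> k dvd j"
    hence "g [^] (j mod k) \<notin> B" using k by (intro kmin) (auto simp: mod_greater_zero_iff_not_dvd)
    moreover have "g [^] j = (g [^] k) [^] (j div k) \<otimes> g [^] (j mod k)"
      using g by (simp add: nat_pow_pow nat_pow_mult)
    hence "g [^] (j mod k) = inv ((g [^] k) [^] (j div k)) \<otimes> g [^] j"
      using g by (simp add: inv_solve_left)
    hence "g [^] (j mod k) \<in> B" using j k Bm Bi Bpow by simp
    ultimately show False by simp
  qed
  \<comment> \<open>The subgroup generated by \<open>B\<close> and \<open>g\<close>; restricting the
    exponents bounds its size.\<close>
  define C where "C = {b \<otimes> g [^] i | b i. b \<in> B \<and> i < k}"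
  have inC: "b \<otimes> g [^] i \<in> C" if "b \<in> B" for b and i :: nat
  proof -
    have "b \<otimes> g [^] i = b \<otimes> ((g [^] k) [^] (i div k) \<otimes> g [^] (i mod k))"
      using g by (simp add: nat_pow_pow nat_pow_mult)
    also have "\<dots> = (b \<otimes> (g [^] k) [^] (i div k)) \<otimes> g [^] (i mod k)"
      using g BG[OF that] by (simp add: m_assoc)
    finally show ?thesis unfolding C_def using that k Bm Bpow by fastforce
  qed
  have mult: "(b \<otimes> g [^] i) \<otimes> (c \<otimes> g [^] j) = (b \<otimes> c) \<otimes> g [^] (i + j)"
    if "b \<in> B" "c \<in> B" for b c and i j :: nat
    using BG[OF that(1)] BG[OF that(2)] g by (simp add: nat_pow_mult[symmetric] m_ac)
  have C: "subgroup C G"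
  proof
    show "C \<subseteq> carrier G" using BG g by (auto simp: C_def)
    show "\<one> \<in> C" using inC[OF B1, of 0] by simp
    show "x \<otimes> y \<in> C" if "x \<in> C" "y \<in> C" for x y
    proof -
      from that obtain b c and i j :: nat where "x = b \<otimes> g [^] i" "b \<in> B" "y = c \<otimes> g [^] j" "c \<in> B"
        unfolding C_def by blast
      thus ?thesis using mult inC Bm by simp
    qed
    show "inv x \<in> C" if "x \<in> C" for x
    proof -
      from that obtain b and i :: nat where x: "x = b \<otimes> g [^] i" "b \<in> B" "i < k" unfolding C_def by blast
      \<comment> \<open>The exponent \<open>- i\<close> is written as \<open>(k - i) - k\<close>,
        and the part \<open>- k\<close> is absorbed into \<open>B\<close>.\<close>
      let ?c = "inv b \<otimes> inv (g [^] k)"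
      have c: "?c \<in> B" using x k Bm Bi by simp
      have "x \<otimes> (?c \<otimes> g [^] (k - i)) = (b \<otimes> ?c) \<otimes> g [^] k"
        using mult[OF x(2) c, of i "k - i"] x by simp
      also have "\<dots> = \<one>" using BG[OF x(2)] g by (simp add: m_assoc[symmetric])
      finally have "x \<otimes> (?c \<otimes> g [^] (k - i)) = \<one>" .
      moreover have "x \<in> carrier G" "?c \<otimes> g [^] (k - i) \<in> carrier G"
        using BG[OF x(2)] BG[OF c] x(1) g by auto
      ultimately have "inv x = ?c \<otimes> g [^] (k - i)" using inv_equality m_comm by metis
      thus ?thesis using inC[OF c] by simp
    qed
  qed
  have "B \<subseteq> C" using inC[of _ 0] BG by fastforce
  moreover have "g \<in> C" using inC[OF B1, of 1] g by simp
  ultimately have BC: "B \<subset> C" using g by blast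
  have finB: "finite B" using fin B by (meson finite_subset subgroup.subset)
  have "C = (\<lambda>(b, i). b \<otimes> g [^] i) ` (B \<times> {..<k})" unfolding C_def by auto
  hence cardC: "card C \<le> card B * k"
    using card_image_le[of "B \<times> {..<k}" "\<lambda>(b, i). b \<otimes> g [^] i"] finB by (simp add: card_cartesian_product)
  define R where "R \<chi> = {\<zeta>::complex. \<zeta> ^ k = \<chi> (g [^] k)}" for \<chi> :: "'a \<Rightarrow> complex"
  \<comment> \<open>The value is read off any representation \<open>b \<otimes> g [^] i\<close>: two
    representations differ by a power of \<open>g [^] k\<close>, where \<open>\<chi>\<close> agrees
    with the corresponding power of \<open>\<zeta>\<close>.\<close>
  define ext where "ext = (\<lambda>(\<chi>, \<zeta>) x. if x \<in> C then
    (THE z. \<exists>b i. b \<in> B \<and> x = b \<otimes> g [^] (i::nat) \<and> z = \<chi> b * \<zeta> ^ i) else undefined :: complex)"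
  have ext: "ext (\<chi>, \<zeta>) (b \<otimes> g [^] i) = \<chi> b * \<zeta> ^ i"
    if \<chi>: "\<chi> \<in> F" and \<zeta>: "\<zeta> \<in> R \<chi>" and b: "b \<in> B" for \<chi> \<zeta> b and i :: nat
  proof -
    have uc: "unit_character G B \<chi>" using X \<chi> by blast
    have wd: "\<chi> b * \<zeta> ^ i = \<chi> c * \<zeta> ^ j"
      if "b \<in> B" "c \<in> B" "b \<otimes> g [^] i = c \<otimes> g [^] j" "i \<le> j" for b c and i j :: nat
    proof -
      note bc = BG[OF that(1)] BG[OF that(2)]
      have "c \<otimes> g [^] (j - i) \<otimes> g [^] i = b \<otimes> g [^] i"
        using that bc g by (simp add: m_assoc nat_pow_mult)
      hence beq: "b = c \<otimes> g [^] (j - i)" using bc g by simp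
      hence "g [^] (j - i) = inv c \<otimes> b" using bc g by (simp add: inv_solve_left)
      hence "k dvd j - i" using kdvd Bm Bi that by simp
      then obtain l where l: "j - i = k * l" by blast
      have "\<chi> b = \<chi> c * \<chi> ((g [^] k) [^] l)"
        using beq l uc that g Bpow[OF k(2)] by (simp add: unit_character_def nat_pow_pow)
      also have "\<chi> ((g [^] k) [^] l) = \<zeta> ^ (j - i)"
        using unit_character_pow[OF B uc k(2)] \<zeta> by (simp add: R_def l power_mult)
      finally show ?thesis using that by (simp flip: power_add)
    qed
    have "(THE z. \<exists>c j. c \<in> B \<and> b \<otimes> g [^] i = c \<otimes> g [^] (j::nat) \<and> z = \<chi> c * \<zeta> ^ j) = \<chi> b * \<zeta> ^ i"
    proof (rule the_equality)
      show "z = \<chi> b * \<zeta> ^ i" if z: "\<exists>c j. c \<in> B \<and> b \<otimes> g [^] i = c \<otimes> g [^] (j::nat) \<and> z = \<chi> c * \<zeta> ^ j" for z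
      proof -
        from z obtain c and j :: nat where "c \<in> B" "b \<otimes> g [^] i = c \<otimes> g [^] j" "z = \<chi> c * \<zeta> ^ j" by blast
        thus ?thesis using wd[of b c i j] wd[of c b j i] b by (cases "i \<le> j") auto
      qed
    qed (use b in blast)
    thus ?thesis using inC[OF b] by (simp add: ext_def)
  qed
  define F' where "F' = ext ` Sigma F R"
  have val: "cmod (\<chi> b) = 1" "\<chi> (b \<otimes> c) = \<chi> b * \<chi> c" if "\<chi> \<in> F" "b \<in> B" "c \<in> B" for \<chi> b c
    using X that by (auto simp: unit_character_def)
  have root: "cmod \<zeta> = 1" if "\<chi> \<in> F" "\<zeta> \<in> R \<chi>" for \<chi> \<zeta>
  proof -
    have "cmod \<zeta> ^ k = 1" using that val(1)[OF that(1) k(2) k(2)] by (simp add: R_def flip: norm_power)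
    thus ?thesis using power_eq_imp_eq_base[of "cmod \<zeta>" k 1] k(1) by simp
  qed
  have cardR: "card (R \<chi>) = k" if "\<chi> \<in> F" for \<chi>
  proof -
    have "\<chi> (g [^] k) \<noteq> 0" using val(1)[OF that k(2) k(2)] by auto
    thus ?thesis unfolding R_def using k(1) by (rule card_nth_roots)
  qed
  hence finR: "finite (R \<chi>)" if "\<chi> \<in> F" for \<chi> using that k(1) by (metis card_gt_0_iff)
  have "inj_on ext (Sigma F R)"
  proof (rule inj_onI)
    fix p p' assume p: "p \<in> Sigma F R" "p' \<in> Sigma F R" "ext p = ext p'"
    obtain \<chi> \<zeta> \<chi>' \<zeta>' where pp: "p = (\<chi>, \<zeta>)" "p' = (\<chi>', \<zeta>')" by (cases p, cases p')
    \<comment> \<open>Exponent 0 recovers \<open>\<chi>\<close>; then \<open>b = \<one>\<close> with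
      exponent 1 recovers \<open>\<zeta>\<close>.\<close>
    have eq: "\<chi> b * \<zeta> ^ i = \<chi>' b * \<zeta>' ^ i" if "b \<in> B" for b and i :: nat
      using ext[of \<chi> \<zeta> b i] ext[of \<chi>' \<zeta>' b i] that p by (simp add: pp)
    have "\<chi> = \<chi>'"
    proof (rule extensionalityI)
      show "\<chi> b = \<chi>' b" if "b \<in> B" for b using eq[OF that, of 0] by simp
    qed (use p pp X in \<open>auto simp: unit_character_def\<close>)
    moreover have "\<chi> \<one> \<noteq> 0" using p pp val(1)[OF _ B1 B1] by force
    ultimately show "p = p'" using eq[OF B1, of 1] pp by simp
  qed
  hence "card F' = (\<Sum>\<chi>\<in>F. card (R \<chi>))"
    unfolding F'_def using X finR by (simp add: card_image)
  also have "\<dots> = card F * k" using cardR by simp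
  finally have "card F' \<ge> card C" using cardC X(2) by (metis mult_le_mono1 order_trans)
  moreover have "finite F'" unfolding F'_def using X finR by auto
  moreover have "unit_character G C \<psi>" if \<psi>: "\<psi> \<in> F'" for \<psi>
  proof -
    obtain \<chi> \<zeta> where \<chi>: "\<psi> = ext (\<chi>, \<zeta>)" "\<chi> \<in> F" "\<zeta> \<in> R \<chi>" using \<psi> by (auto simp: F'_def)
    show ?thesis unfolding unit_character_def
    proof (intro conjI ballI)
      show "\<psi> \<in> extensional C" by (simp add: \<chi> ext_def extensional_def)
      fix x assume "x \<in> C"
      then obtain b and i :: nat where x: "x = b \<otimes> g [^] i" "b \<in> B" unfolding C_def by blast
      show "cmod (\<psi> x) = 1"
        using x \<chi> val(1) root by (simp add: ext norm_mult norm_power)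
      fix y assume "y \<in> C"
      then obtain c and j :: nat where y: "y = c \<otimes> g [^] j" "c \<in> B" unfolding C_def by blast
      show "\<psi> (x \<otimes> y) = \<psi> x * \<psi> y"
        using x y \<chi> mult Bm by (simp add: ext val(2) power_add)
    qed
  qed
  ultimately show thesis using that[OF C BC] by blast
qed

text \<open>A maximal subgroup among those with enough characters is the whole group by the
  extension step; the trivial subgroup shows that there is one.\<close>

lemma ex_many_unit_characters:
  assumes fin: "finite (carrier G)"
  obtains F where "finite F" "card F \<ge> card (carrier G)" "\<forall>\<chi>\<in>F. unit_character G (carrier G) \<chi>"
proof -
  define Q where "Q B \<longleftrightarrow> subgroup B G \<and> (\<exists>F. finite F \<and> card F \<ge> card B \<and> (\<forall>\<chi>\<in>F. unit_character G B \<chi>))" for B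
  have "Q {\<one>}" unfolding Q_def
    by (intro conjI triv_subgroup exI[of _ "{\<lambda>x. if x = \<one> then 1 else undefined}"])
       (auto simp: unit_character_def extensional_def)
  moreover have bound: "B \<in> Pow (carrier G)" if "Q B" for B
    using that subgroup.subset by (auto simp: Q_def)
  ultimately obtain B where B: "Q B" and max: "\<And>C. Q C \<Longrightarrow> \<not> B \<subset> C"
  proof -
    have "finite {B. Q B}" using bound fin by (intro finite_subset[of "{B. Q B}" "Pow (carrier G)"]) auto
    from finite_has_maximal[OF this] show thesis using that \<open>Q {\<one>}\<close> by auto
  qed
  have "B = carrier G"
  proof (rule ccontr)
    assume "B \<noteq> carrier G"
    then obtain g where "g \<in> carrier G" "g \<notin> B" using bound[OF B] by auto
    then obtain C where "Q C" "B \<subset> C"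
      using B extend_unit_characters[OF fin, of B g] unfolding Q_def by metis
    thus False using max by blast
  qed
  thus thesis using that B unfolding Q_def by blast
qed

end

section \<open>Labellings by unit complex numbers\<close>

lemma pi_less_16_div_5: "pi < 16 / 5"
proof (rule ccontr)
  \<comment> \<open>\<open>8 / 15\<close> is one sixth of \<open>16 / 5\<close>, hence the
    comparison with \<open>pi / 6\<close>; the cubic Taylor bound already puts its sine above 1 /
    2.\<close>
  assume "\<not> pi < 16 / 5"
  hence "sin (8 / 15) \<le> sin (pi / 6)" using pi_less_4 by (intro sin_monotone_2pi_le) auto
  also have "\<dots> = 1 / 2" by (rule sin_30)
  finally have "sin (8 / 15 :: real) \<le> 1 / 2" .
  moreover have "\<bar>sin (8 / 15) - (\<Sum>m<3. sin_coeff m * (8 / 15) ^ m)\<bar> \<le> inverse (fact 3) * \<bar>8 / 15 :: real\<bar> ^ 3"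
    by (rule Maclaurin_sin_bound)
  hence "\<bar>sin (8 / 15) - 8 / 15\<bar> \<le> (8 / 15 :: real) ^ 3 / 6"
    by (simp add: eval_nat_numeral sin_coeff_def fact_numeral)
  ultimately show False by (simp add: abs_le_iff power3_eq_cube)
qed

lemma one_minus_cos_le_half_square: "1 - cos x \<le> x\<^sup>2 / 2" for x :: real
proof -
  have "1 - cos x = 2 * (sin (x / 2))\<^sup>2" using cos_double_sin[of "x / 2"] by simp
  moreover have "(sin (x / 2))\<^sup>2 \<le> (x / 2)\<^sup>2" using abs_sin_x_le_abs_x[of "x / 2"] unfolding abs_le_square_iff .
  ultimately show ?thesis by (simp add: power_divide)
qed

text \<open>
  With \<open>q = \<lfloor>5 / \<epsilon>\<rfloor>\<close> one has \<open>\<epsilon> > 5 / (q + 1)\<close>, so the claim follows from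
  \<open>2 * pi\<^sup>2 * (q + 1) \<le> 5 * q\<^sup>2\<close> for \<open>q \<ge> 5\<close> and from \<open>cos (pi / 2) = 0\<close> for \<open>q = 4\<close>.
\<close>
lemma one_minus_cos_floor_le:
  assumes "0 < \<epsilon>" "\<epsilon> \<le> 5 / 4"
  defines "q \<equiv> nat \<lfloor>5 / \<epsilon>\<rfloor>"
  shows "4 \<le> q" "real q \<le> 5 / \<epsilon>" "1 - cos (2 * pi / q) \<le> \<epsilon>"
proof -
  have "4 \<le> 5 / \<epsilon>" using assms by (simp add: field_simps)
  hence "4 \<le> \<lfloor>5 / \<epsilon>\<rfloor>" by (simp add: le_floor_iff)
  thus q4: "4 \<le> q" unfolding q_def by linarith
  have q: "real q = of_int \<lfloor>5 / \<epsilon>\<rfloor>" using \<open>4 \<le> \<lfloor>5 / \<epsilon>\<rfloor>\<close> unfolding q_def by linarith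
  thus "real q \<le> 5 / \<epsilon>" by simp
  have "5 / \<epsilon> < real q + 1" using q by linarith
  hence \<epsilon>: "5 / (real q + 1) < \<epsilon>" using assms(1) by (simp add: pos_divide_less_eq mult.commute)
  show "1 - cos (2 * pi / q) \<le> \<epsilon>"
  proof (cases "q = 4")
    case True
    thus ?thesis using \<epsilon> by simp
  next
    case False
    hence q5: "real q \<ge> 5" using q4 by simp
    have "pi\<^sup>2 \<le> (16 / 5)\<^sup>2" using pi_less_16_div_5 by (intro power_mono) auto
    hence pi2: "pi\<^sup>2 \<le> 10.24" by (simp add: power2_eq_square)
    \<comment> \<open>The tangent of the square at 5, \<open>10 * q - 25\<close>, is a sufficient
      lower bound for all \<open>q \<ge> 5\<close>.\<close>
    have "(real q - 5)\<^sup>2 \<ge> 0" by simp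
    hence "20.48 * (real q + 1) \<le> 5 * (real q)\<^sup>2" using q5 by (simp add: power2_eq_square algebra_simps)
    moreover have "2 * pi\<^sup>2 * (real q + 1) \<le> 20.48 * (real q + 1)"
      using pi2 by (intro mult_right_mono) auto
    ultimately have *: "2 * pi\<^sup>2 * (real q + 1) \<le> 5 * (real q)\<^sup>2" by linarith
    have "1 - cos (2 * pi / q) \<le> (2 * pi / q)\<^sup>2 / 2" by (rule one_minus_cos_le_half_square)
    also have "\<dots> = 2 * pi\<^sup>2 / (real q)\<^sup>2" by (simp add: power_divide power_mult_distrib)
    also have "\<dots> \<le> 5 / (real q + 1)" using * q5 by (simp add: field_simps)
    finally show ?thesis using \<epsilon> by simp
  qed
qed

text \<open>\<open>Arg\<close> takes values in (-pi, pi], so \<open>pi - Arg z\<close> lies in [0, 2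
  pi) and the floor never reaches \<open>q\<close>. The half-open arcs are numbered clockwise from
  the negative real axis.\<close>

definition arc_index :: "nat \<Rightarrow> complex \<Rightarrow> nat" where
  "arc_index q z = nat \<lfloor>real q * (pi - Arg z) / (2 * pi)\<rfloor>"

lemma arc_index_less:
  assumes "q > 0"
  shows "arc_index q z < q"
proof -
  have "pi - Arg z < 2 * pi" using Arg_bounded[of z] by simp
  hence "real q * (pi - Arg z) < real q * (2 * pi)" using assms by (intro mult_strict_left_mono) auto
  hence "real q * (pi - Arg z) / (2 * pi) < real q" by (simp add: pos_divide_less_eq)
  hence "\<lfloor>real q * (pi - Arg z) / (2 * pi)\<rfloor> < int q" by linarith
  thus ?thesis unfolding arc_index_def using assms by linarith
qed

text \<open>Equal floors put the arguments at distance strictly below \<open>2 * pi / q\<close>, and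
  \<open>q \<ge> 2\<close> keeps this within [0, pi], where the cosine decreases. The strictness is
  what later contradicts the gap.\<close>

lemma arc_index_eq_imp_Re_gt:
  assumes q: "q \<ge> 2" and z: "cmod z = 1" and w: "cmod w = 1" and eq: "arc_index q z = arc_index q w"
  shows "Re (z * cnj w) > cos (2 * pi / q)"
proof -
  have nonneg: "0 \<le> real q * (pi - Arg z) / (2 * pi)" for z using Arg_bounded[of z] by simp
  have "\<lfloor>real q * (pi - Arg z) / (2 * pi)\<rfloor> = \<lfloor>real q * (pi - Arg w) / (2 * pi)\<rfloor>"
    using eq nonneg[of z] nonneg[of w] unfolding arc_index_def by (simp add: eq_nat_nat_iff)
  hence "\<bar>real q * (pi - Arg z) / (2 * pi) - real q * (pi - Arg w) / (2 * pi)\<bar> < 1" by linarith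
  hence "\<bar>real q * (Arg w - Arg z) / (2 * pi)\<bar> < 1" by (simp add: algebra_simps diff_divide_distrib)
  hence "real q * \<bar>Arg z - Arg w\<bar> < 2 * pi" by (simp add: abs_mult pos_divide_less_eq abs_minus_commute)
  hence "\<bar>Arg z - Arg w\<bar> < 2 * pi / q" using q by (simp add: pos_less_divide_eq mult.commute)
  moreover have "2 * pi / q \<le> pi" using q by (simp add: field_simps)
  ultimately have "cos (2 * pi / q) < cos \<bar>Arg z - Arg w\<bar>" by (intro cos_monotone_0_pi) auto
  also have "\<dots> = Re (cis (Arg z - Arg w))" by simp
  also have "cis (Arg z - Arg w) = cis (Arg z) * cnj (cis (Arg w))" by (simp add: cis_mult cis_cnj)
  also have "\<dots> = z * cnj w" using z w by (metis cis_Arg norm_zero sgn_eq zero_neq_one div_by_1 of_real_1)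
  finally show ?thesis .
qed

text \<open>
  Only one element of each two-element orbit of \<open>\<tau>\<close> needs an arc, and at a fixed point the label is
  \<open>1\<close> or \<open>-1\<close>; since \<open>2 \<le> sqrt q\<close>, there are at most \<open>sqrt q ^ card D\<close> patterns.
\<close>
lemma ex_close_unit_labellings:
  fixes val :: "'c \<Rightarrow> 'e \<Rightarrow> complex"
  assumes D: "finite D" and F: "finite F"
    and \<tau>: "\<And>e. e \<in> D \<Longrightarrow> \<tau> e \<in> D" "\<And>e. e \<in> D \<Longrightarrow> \<tau> (\<tau> e) = e"
    and unit: "\<And>\<chi> e. \<chi> \<in> F \<Longrightarrow> e \<in> D \<Longrightarrow> cmod (val \<chi> e) = 1"
    and cnj: "\<And>\<chi> e. \<chi> \<in> F \<Longrightarrow> e \<in> D \<Longrightarrow> val \<chi> (\<tau> e) = cnj (val \<chi> e)"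
    and q: "q \<ge> 4" and large: "q ^ card D < (card F)\<^sup>2"
  obtains \<chi> \<chi>' where "\<chi> \<in> F" "\<chi>' \<in> F" "\<chi> \<noteq> \<chi>'"
    "\<And>e. e \<in> D \<Longrightarrow> Re (val \<chi> e * cnj (val \<chi>' e)) > cos (2 * pi / q)"
proof -
  \<comment> \<open>An arbitrary numbering of \<open>D\<close>, used to choose one element from each
    two-element orbit of \<open>\<tau>\<close>.\<close>
  obtain \<iota> :: "'e \<Rightarrow> nat" where \<iota>: "inj_on \<iota> D"
    using finite_imp_inj_to_nat_seg[OF D] by blast
  define D\<^sub>0 where "D\<^sub>0 = {e \<in> D. \<tau> e = e}"
  define D\<^sub>1 where "D\<^sub>1 = {e \<in> D. \<iota> e < \<iota> (\<tau> e)}"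
  define D\<^sub>2 where "D\<^sub>2 = {e \<in> D. \<iota> (\<tau> e) < \<iota> e}"
  have split: "D = D\<^sub>0 \<union> D\<^sub>1 \<union> D\<^sub>2"
  proof -
    have "\<iota> e \<noteq> \<iota> (\<tau> e)" if "e \<in> D" "\<tau> e \<noteq> e" for e
      using inj_onD[OF \<iota>, of e "\<tau> e"] that \<tau> by auto
    thus ?thesis unfolding D\<^sub>0_def D\<^sub>1_def D\<^sub>2_def by force
  qed
  have fin: "finite D\<^sub>0" "finite D\<^sub>1" "finite D\<^sub>2" using D by (auto simp: D\<^sub>0_def D\<^sub>1_def D\<^sub>2_def)
  have disj: "D\<^sub>0 \<inter> D\<^sub>1 = {}" "(D\<^sub>0 \<union> D\<^sub>1) \<inter> D\<^sub>2 = {}" by (auto simp: D\<^sub>0_def D\<^sub>1_def D\<^sub>2_def)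
  have "bij_betw \<tau> D\<^sub>1 D\<^sub>2"
    by (rule bij_betw_byWitness[where f' = \<tau>]) (auto simp: D\<^sub>1_def D\<^sub>2_def \<tau>)
  hence "card D\<^sub>2 = card D\<^sub>1" by (simp add: bij_betw_same_card)
  hence cardD: "card D = card D\<^sub>0 + 2 * card D\<^sub>1"
    by (simp add: split card_Un_disjoint fin disj)
  define pattern where "pattern \<chi> = (\<lambda>e\<in>D\<^sub>0 \<union> D\<^sub>1. if e \<in> D\<^sub>0 then of_bool (val \<chi> e = 1) else arc_index q (val \<chi> e))" for \<chi>
  define T where "T e = (if e \<in> D\<^sub>0 then {..<2} else {..<q})" for e
  have "card (PiE (D\<^sub>0 \<union> D\<^sub>1) T) = (\<Prod>e\<in>D\<^sub>0 \<union> D\<^sub>1. card (T e))"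
    using fin by (intro card_PiE) auto
  also have "\<dots> = (\<Prod>e\<in>D\<^sub>0. card (T e)) * (\<Prod>e\<in>D\<^sub>1. card (T e))"
    by (rule prod.union_disjoint[OF fin(1,2) disj(1)])
  also have "(\<Prod>e\<in>D\<^sub>0. card (T e)) = 2 ^ card D\<^sub>0" by (simp add: T_def)
  also have "(\<Prod>e\<in>D\<^sub>1. card (T e)) = (\<Prod>e\<in>D\<^sub>1. q)"
    using disj by (intro prod.cong) (auto simp: T_def)
  finally have cardT: "card (PiE (D\<^sub>0 \<union> D\<^sub>1) T) = 2 ^ card D\<^sub>0 * q ^ card D\<^sub>1" by simp
  \<comment> \<open>Squaring turns the 2 patterns at a fixed point into \<open>4 \<le> q\<close>,
    and the \<open>q\<close> patterns of a pair into one factor \<open>q\<close> for each of its two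
    elements.\<close>
  have "(card (PiE (D\<^sub>0 \<union> D\<^sub>1) T))\<^sup>2 = 4 ^ card D\<^sub>0 * q ^ (2 * card D\<^sub>1)"
  proof -
    have "((2::nat) ^ n)\<^sup>2 = 4 ^ n" for n by (simp add: power2_eq_square flip: power_mult_distrib)
    thus ?thesis unfolding cardT by (simp add: power_mult_distrib power_mult power_commutes flip: power_even_eq)
  qed
  also have "\<dots> \<le> q ^ card D\<^sub>0 * q ^ (2 * card D\<^sub>1)"
    using q by (intro mult_right_mono power_mono) auto
  also have "\<dots> = q ^ card D" by (simp add: cardD power_add)
  finally have "(card (PiE (D\<^sub>0 \<union> D\<^sub>1) T))\<^sup>2 < (card F)\<^sup>2" using large by simp
  hence "card (PiE (D\<^sub>0 \<union> D\<^sub>1) T) < card F" by (rule power2_less_imp_less) simp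
  moreover have "pattern ` F \<subseteq> PiE (D\<^sub>0 \<union> D\<^sub>1) T"
    unfolding pattern_def by (intro image_subsetI) (use q in \<open>simp add: restrict_PiE_iff T_def arc_index_less\<close>)
  hence "card (pattern ` F) \<le> card (PiE (D\<^sub>0 \<union> D\<^sub>1) T)"
    using fin by (intro card_mono finite_PiE) (auto simp: T_def)
  ultimately have "\<not> inj_on pattern F" using pigeonhole by (metis order.strict_trans1)
  then obtain \<chi> \<chi>' where \<chi>: "\<chi> \<in> F" "\<chi>' \<in> F" "\<chi> \<noteq> \<chi>'" "pattern \<chi> = pattern \<chi>'"
    unfolding inj_on_def by blast
  have cos1: "cos (2 * pi / q) < 1"
  proof -
    have "cos (2 * pi / q) < cos 0" using q by (intro cos_monotone_0_pi) (auto simp: field_simps)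
    thus ?thesis by simp
  qed
  have D1: "Re (val \<chi> e * cnj (val \<chi>' e)) > cos (2 * pi / q)" if "e \<in> D\<^sub>1" for e
  proof (rule arc_index_eq_imp_Re_gt)
    have e: "e \<in> D" "e \<notin> D\<^sub>0" using that disj by (auto simp: D\<^sub>1_def)
    show "cmod (val \<chi> e) = 1" "cmod (val \<chi>' e) = 1" using unit \<chi> e by auto
    show "arc_index q (val \<chi> e) = arc_index q (val \<chi>' e)"
      using fun_cong[OF \<chi>(4), of e] that e by (simp add: pattern_def)
  qed (use q in simp)
  have D2: "Re (val \<chi> e * cnj (val \<chi>' e)) > cos (2 * pi / q)" if "e \<in> D\<^sub>2" for e
  proof -
    have "e \<in> D" "\<tau> e \<in> D\<^sub>1" using that \<tau> by (auto simp: D\<^sub>1_def D\<^sub>2_def)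
    thus ?thesis using D1[of "\<tau> e"] cnj \<chi> by simp
  qed
  have D0: "Re (val \<chi> e * cnj (val \<chi>' e)) > cos (2 * pi / q)" if "e \<in> D\<^sub>0" for e
  proof -
    have e: "e \<in> D" "\<tau> e = e" using that by (auto simp: D\<^sub>0_def)
    have pm: "val \<psi> e = 1 \<or> val \<psi> e = -1" if "\<psi> \<in> F" for \<psi>
    proof -
      have "val \<psi> e = cnj (val \<psi> e)" using cnj[OF that e(1)] e(2) by simp
      hence "Im (val \<psi> e) = 0" by (metis add.inverse_neutral cnj.sel(2) equal_neg_zero)
      thus ?thesis using unit[OF that e(1)] by (auto simp: cmod_def complex_eq_iff abs_if split: if_splits)
    qed
    have "(val \<chi> e = 1) = (val \<chi>' e = 1)"
      using fun_cong[OF \<chi>(4), of e] that by (simp add: pattern_def of_bool_eq_iff)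
    hence "val \<chi> e * cnj (val \<chi>' e) = 1" using pm[OF \<chi>(1)] pm[OF \<chi>(2)] by auto
    thus ?thesis using cos1 by simp
  qed
  show thesis using that[OF \<chi>(1-3)] D0 D1 D2 split by blast
qed

section \<open>Induced characters on the Schreier graph\<close>

lemma sum_mset_gt_size_mult:
  fixes f :: "'a \<Rightarrow> real"
  assumes "M \<noteq> {#}" "\<And>x. x \<in># M \<Longrightarrow> c < f x"
  shows "real (size M) * c < (\<Sum>x\<in>#M. f x)"
  using assms
proof (induction M)
  case (add x M)
  thus ?case by (cases "M = {#}") (auto simp: algebra_simps intro: add_strict_mono)
qed simp

section \<open>Cosets and edge labels\<close>

definition coset_rep :: "'a set \<Rightarrow> 'a" where
  "coset_rep C = (SOME g. g \<in> C)"

text \<open>A Schreier generator \<open>r' s r^-1\<close>, where \<open>r\<close> and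
  \<open>r'\<close> represent the two end cosets. The inverse of \<open>s\<close> appears because
  the point \<open>g w\<close> belongs to the coset \<open>H g^-1\<close>, so acting by
  \<open>s\<close> on the left translates cosets by \<open>inv s\<close> on the right.\<close>

definition edge_elt :: "('a, 'b) monoid_scheme \<Rightarrow> 'a set \<Rightarrow> 'a \<Rightarrow> 'a" where
  "edge_elt G C s = coset_rep (C #>\<^bsub>G\<^esub> inv\<^bsub>G\<^esub> s) \<otimes>\<^bsub>G\<^esub> s \<otimes>\<^bsub>G\<^esub> inv\<^bsub>G\<^esub> coset_rep C"

context group begin

lemma coset_rep:
  assumes "subgroup H G" "C \<in> rcosets H"
  shows "coset_rep C \<in> C" "coset_rep C \<in> carrier G" "C = H #> coset_rep C"
proof -
  have "C \<noteq> {}" using subgroup.rcosets_non_empty assms by blast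
  thus 1: "coset_rep C \<in> C" unfolding coset_rep_def by (simp add: some_in_eq)
  thus 2: "coset_rep C \<in> carrier G" using subgroup.rcosets_carrier[OF assms(1) is_group assms(2)] by blast
  obtain g where "g \<in> carrier G" "C = H #> g" using assms(2) by (auto simp: RCOSETS_def)
  thus "C = H #> coset_rep C" using repr_independence[of "coset_rep C" H g] 1 assms(1) by simp
qed

lemma rcosets_translate:
  assumes "subgroup H G" "C \<in> rcosets H" "s \<in> carrier G"
  shows "C #> s \<in> rcosets H"
  using coset_rep[OF assms(1,2)] assms
  by (metis coset_mult_assoc m_closed rcosetsI subgroup.subset)

lemma edge_elt_closed:
  assumes H: "subgroup H G" and C: "C \<in> rcosets H" and s: "s \<in> carrier G"
  shows "edge_elt G C s \<in> H"
proof -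
  let ?r = "coset_rep C" and ?r' = "coset_rep (C #> inv s)"
  have C': "C #> inv s \<in> rcosets H" using rcosets_translate[OF H C] s by simp
  note r = coset_rep[OF H C] and r' = coset_rep[OF H C']
  have "C #> inv s = H #> (?r \<otimes> inv s)"
    using r(2) s subgroup.subset[OF H] by (subst r(3)) (simp add: coset_mult_assoc)
  hence "?r' \<otimes> inv (?r \<otimes> inv s) \<in> H"
    using r'(1) subgroup.rcos_module_imp[OF H is_group, of "?r \<otimes> inv s" ?r'] r(2) s by simp
  thus ?thesis using r(2) r'(2) s by (simp add: edge_elt_def inv_mult_group m_assoc)
qed

text \<open>Traversing an edge backwards inverts its label, so unit characters give reversed edges
  conjugate values.\<close>

lemma edge_elt_inv:
  assumes H: "subgroup H G" and C: "C \<in> rcosets H" and s: "s \<in> carrier G"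
  shows "edge_elt G (C #> inv s) (inv s) = inv (edge_elt G C s)"
proof -
  have C': "C #> inv s \<in> rcosets H" using rcosets_translate[OF H C] s by simp
  have "C #> inv s #> s = C"
    using s subgroup.rcosets_carrier[OF H is_group C] by (simp add: coset_mult_assoc)
  thus ?thesis using coset_rep(2)[OF H C] coset_rep(2)[OF H C'] s
    by (simp add: edge_elt_def inv_mult_group m_assoc)
qed

end

lemma (in group_action) diff_in_stabilizer:
  assumes "w \<in> E" "g \<in> carrier G" "g' \<in> carrier G" "\<phi> g w = \<phi> g' w"
  shows "inv g' \<otimes> g \<in> stabilizer G \<phi> w"
proof -
  interpret group G using group_hom group_hom.axioms(1) by auto
  have "\<phi> (inv g') (\<phi> g w) = w" using orbit_sym_aux[OF assms(3,1)] assms(4) by simp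
  thus ?thesis using assms by (simp add: stabilizer_def composition_rule)
qed

text \<open>Makes \<open>g w \<mapsto> H g^-1\<close> well defined: elements with the same image of
  \<open>w\<close> differ on the right by the stabilizer, hence after inversion on the left by an
  element of \<open>H\<close>.\<close>

lemma (in group_action) rcoset_inv_cong:
  assumes w: "w \<in> E" and g: "g \<in> carrier G" "g' \<in> carrier G" "\<phi> g w = \<phi> g' w"
    and H: "subgroup H G" "stabilizer G \<phi> w \<subseteq> H"
  shows "H #> inv g = H #> inv g'"
proof -
  interpret group G using group_hom group_hom.axioms(1) by auto
  define k where "k = inv g' \<otimes> g"
  have k: "k \<in> H" using diff_in_stabilizer[OF w g] H(2) by (auto simp: k_def)
  hence kG: "k \<in> carrier G" using H(1) subgroup.mem_carrier by metis
  have "g = g' \<otimes> k" using g by (simp add: k_def m_assoc[symmetric])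
  hence "inv g = inv k \<otimes> inv g'" using g kG by (simp add: inv_mult_group)
  hence "H #> inv g = (H #> inv k) #> inv g'"
    using g kG subgroup.subset[OF H(1)] by (simp add: coset_mult_assoc)
  also have "H #> inv k = H" using coset_join2[of "inv k" H] kG H(1) subgroup.m_inv_closed[OF H(1) k] by simp
  finally show ?thesis .
qed

text \<open>
  The character \<open>\<chi>\<close> of \<open>H\<close> induces the unit function \<open>g \<omega> \<mapsto> \<chi> (r g)\<close> on \<open>E\<close>, where \<open>r\<close> represents the
  coset \<open>H g\<^sup>-\<^sup>1\<close>.  Conjugates of an element outside the kernel of \<open>\<chi>\<close> show that its sum vanishes,
  and its value changes by the factor \<open>\<chi> (edge_elt G C s)\<close> along an edge, so that the average of these
  factors is a Rayleigh quotient.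
\<close>
lemma (in transitive_action) ex_edge_far_from_one:
  fixes \<chi> :: "'a \<Rightarrow> complex"
  assumes fin: "finite E" and card: "card E \<ge> 2" and w: "w \<in> E"
    and S: "symmetric_mset G S" "S \<noteq> {#}"
    and \<epsilon>: "\<epsilon> > 0" "gap (schreier_graph E \<phi> S) \<ge> \<epsilon>"
    and H: "subgroup H G" "stabilizer G \<phi> w \<subseteq> H"
    and unit: "\<And>h. h \<in> H \<Longrightarrow> cmod (\<chi> h) = 1"
    and mult: "\<And>h k. h \<in> H \<Longrightarrow> k \<in> H \<Longrightarrow> \<chi> (h \<otimes> k) = \<chi> h * \<chi> k"
    and stab: "\<And>k. k \<in> stabilizer G \<phi> w \<Longrightarrow> \<chi> k = 1"
    and h0: "h0 \<in> H" "\<chi> h0 \<noteq> 1"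
  shows "\<exists>C\<in>rcosets H. \<exists>s\<in>#S. Re (\<chi> (edge_elt G C s)) \<le> 1 - \<epsilon>"
proof (rule ccontr)
  assume "\<not> ?thesis"
  hence close: "Re (\<chi> (edge_elt G C s)) > 1 - \<epsilon>" if "C \<in> rcosets H" "s \<in># S" for C s
    using that by force
  interpret group G using group_hom group_hom.axioms(1) by auto
  have HG: "h \<in> carrier G" if "h \<in> H" for h using H(1) that by (rule subgroup.mem_carrier)
  have SG: "s \<in> carrier G" if "s \<in># S" for s using S(1) that by (auto simp: symmetric_mset_def)
  define \<gamma> where "\<gamma> x = (SOME g. g \<in> carrier G \<and> \<phi> g w = x)" for x
  define c where "c x = H #> inv (\<gamma> x)" for x
  define f where "f x = \<chi> (coset_rep (c x) \<otimes> \<gamma> x)" for x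
  have \<gamma>: "\<gamma> x \<in> carrier G" "\<phi> (\<gamma> x) w = x" if "x \<in> E" for x
    using someI_ex[of "\<lambda>g. g \<in> carrier G \<and> \<phi> g w = x"] unique_orbit[OF w that] unfolding \<gamma>_def by auto
  have cH: "c x \<in> rcosets H" if "x \<in> E" for x
    using \<gamma>[OF that] subgroup.subset[OF H(1)] by (simp add: c_def rcosetsI)
  have repH: "coset_rep (H #> inv g) \<otimes> g \<in> H" if g: "g \<in> carrier G" for g
  proof -
    have "H #> inv g \<in> rcosets H" using g subgroup.subset[OF H(1)] by (simp add: rcosetsI)
    from coset_rep[OF H(1) this] show ?thesis
      using subgroup.rcos_module_imp[OF H(1) is_group, of "inv g" "coset_rep (H #> inv g)"] g by simp
  qed
  \<comment> \<open>Independence of the choice of \<open>\<gamma>\<close>: any other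
    \<open>g\<close> with the same image differs by a stabilizer element, where
    \<open>\<chi>\<close> is 1.\<close>
  have c_eq: "c (\<phi> g w) = H #> inv g" and f_eq: "f (\<phi> g w) = \<chi> (coset_rep (H #> inv g) \<otimes> g)"
    if g: "g \<in> carrier G" for g
  proof -
    let ?x = "\<phi> g w"
    have x: "?x \<in> E" using element_image[OF g w refl] .
    define k where "k = inv (\<gamma> ?x) \<otimes> g"
    note gx = \<gamma>[OF x]
    have k: "k \<in> stabilizer G \<phi> w"
      unfolding k_def using g gx by (intro diff_in_stabilizer[OF w]) auto
    hence kH: "k \<in> H" using H(2) by blast
    have g_eq: "g = \<gamma> ?x \<otimes> k" using g gx by (simp add: k_def m_assoc[symmetric])
    show c: "c ?x = H #> inv g"
      unfolding c_def using g gx by (intro rcoset_inv_cong[OF w _ _ _ H]) auto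
    let ?r = "coset_rep (H #> inv g)"
    have r: "?r \<in> carrier G"
      using coset_rep(2)[OF H(1)] g subgroup.subset[OF H(1)] by (simp add: rcosetsI)
    have "\<chi> (?r \<otimes> g) = \<chi> ((?r \<otimes> \<gamma> ?x) \<otimes> k)"
      using r gx HG[OF kH] by (subst g_eq) (simp add: m_assoc)
    also have "\<dots> = f ?x"
      using mult[OF _ kH] stab[OF k] repH[OF gx(1)] by (simp add: f_def c flip: c[unfolded c_def])
    finally show "f ?x = \<chi> (?r \<otimes> g)" by simp
  qed
  have step: "c (\<phi> s x) = c x #> inv s" "f (\<phi> s x) = \<chi> (edge_elt G (c x) s) * f x"
    if x: "x \<in> E" and s: "s \<in> carrier G" for x s
  proof -
    let ?g = "\<gamma> x"
    have sg: "s \<otimes> ?g \<in> carrier G" "inv (s \<otimes> ?g) = inv ?g \<otimes> inv s"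
      using \<gamma>[OF x] s by (simp_all add: inv_mult_group)
    have sx: "\<phi> s x = \<phi> (s \<otimes> ?g) w" using \<gamma>[OF x] s w by (simp add: composition_rule)
    have cs: "H #> inv (s \<otimes> ?g) = c x #> inv s"
      using \<gamma>[OF x] s subgroup.subset[OF H(1)] by (simp add: sg c_def coset_mult_assoc)
    show "c (\<phi> s x) = c x #> inv s" unfolding sx c_eq[OF sg(1)] cs ..
    have r: "coset_rep (c x) \<in> carrier G" "coset_rep (c x #> inv s) \<in> carrier G"
      using coset_rep(2)[OF H(1) cH[OF x]] coset_rep(2)[OF H(1) rcosets_translate[OF H(1) cH[OF x]]] s by simp_all
    have "coset_rep (c x #> inv s) \<otimes> (s \<otimes> ?g) = edge_elt G (c x) s \<otimes> (coset_rep (c x) \<otimes> ?g)"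
      unfolding edge_elt_def using r s \<gamma>[OF x] by (simp add: m_assoc inv_solve_left'[symmetric] r_inv l_inv flip: m_assoc[of "inv _"])
    moreover have "coset_rep (c x) \<otimes> ?g \<in> H" using repH[OF \<gamma>(1)[OF x]] by (simp add: c_def)
    ultimately show "f (\<phi> s x) = \<chi> (edge_elt G (c x) s) * f x"
      unfolding sx f_eq[OF sg(1)] cs using mult edge_elt_closed[OF H(1) cH[OF x] s] by (simp add: f_def)
  qed
  have f1: "cmod (f x) = 1" if "x \<in> E" for x
    using unit repH[OF \<gamma>(1)[OF that]] by (simp add: f_def c_def)
  have sum_f: "(\<Sum>x\<in>E. f x) = 0"
  proof -
    \<comment> \<open>This conjugate of \<open>h0\<close> fixes the coset of \<open>x\<close> and
      multiplies \<open>f x\<close> by \<open>\<chi> h0\<close>. It depends on the coset only, so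
      \<open>p\<close> permutes \<open>E\<close>, and the sum of \<open>f\<close> equals
      \<open>\<chi> h0\<close> times itself.\<close>
    define t where "t x = inv (coset_rep (c x)) \<otimes> h0 \<otimes> coset_rep (c x)" for x
    define p where "p x = \<phi> (t x) x" for x
    have r: "coset_rep (c x) \<in> carrier G" "c x = H #> coset_rep (c x)" if "x \<in> E" for x
      using coset_rep[OF H(1) cH[OF that]] by auto
    have t: "t x \<in> carrier G" if "x \<in> E" for x using r[OF that] HG[OF h0(1)] by (simp add: t_def)
    have ct: "c x #> inv (t x) = c x" if x: "x \<in> E" for x
    proof -
      let ?r = "coset_rep (c x)"
      have "?r \<otimes> inv (t x) = inv h0 \<otimes> ?r"
        using r(1)[OF x] HG[OF h0(1)] by (simp add: t_def inv_mult_group m_assoc[symmetric])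
      hence "H #> ?r #> inv (t x) = H #> inv h0 #> ?r"
        using r(1)[OF x] HG[OF h0(1)] t[OF x] subgroup.subset[OF H(1)] by (simp add: coset_mult_assoc)
      also have "H #> inv h0 = H"
        using coset_join2[of "inv h0" H] HG[OF h0(1)] H(1) subgroup.m_inv_closed[OF H(1) h0(1)] by simp
      finally show ?thesis using r(2)[OF x] by simp
    qed
    have cp: "c (p x) = c x" if "x \<in> E" for x
      using step(1)[OF that t[OF that]] ct[OF that] by (simp add: p_def)
    have fp: "f (p x) = \<chi> h0 * f x" if x: "x \<in> E" for x
    proof -
      have "edge_elt G (c x) (t x) = h0"
        unfolding edge_elt_def ct[OF x] unfolding t_def
        using r(1)[OF x] HG[OF h0(1)] by (simp add: m_assoc) (simp add: m_assoc[symmetric])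
      thus ?thesis using step(2)[OF x t[OF x]] by (simp add: p_def)
    qed
    have "p ` E \<subseteq> E" using element_image t by (auto simp: p_def)
    moreover have "inj_on p E"
    proof (rule inj_onI)
      fix x y assume xy: "x \<in> E" "y \<in> E" "p x = p y"
      hence "c x = c y" using cp by metis
      hence "t x = t y" by (simp add: t_def)
      hence "\<phi> (t x) x = \<phi> (t x) y" using xy by (simp add: p_def)
      thus "x = y" using inj_prop[OF t[OF xy(1)]] xy by (simp add: inj_on_def)
    qed
    ultimately have "bij_betw p E E" using fin by (simp add: bij_betw_def endo_inj_surj)
    hence "(\<Sum>x\<in>E. f x) = (\<Sum>x\<in>E. f (p x))" by (rule sum.reindex_bij_betw[symmetric])
    also have "\<dots> = \<chi> h0 * (\<Sum>x\<in>E. f x)" by (simp add: fp sum_distrib_left)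
    finally show ?thesis using h0(2) by simp
  qed
  define \<Gamma> where "\<Gamma> = schreier_graph E \<phi> S"
  have reg: "regular_graph (size S) \<Gamma>"
    unfolding \<Gamma>_def using schreier_graph_regular[OF group_action_axioms fin S(1)] .
  have V: "vertices \<Gamma> = E" by (simp add: \<Gamma>_def schreier_graph_def)
  have d: "size S > 0" using S(2) by (simp add: nonempty_has_size)
  have avg: "averaging_op \<Gamma> u x = 1 / real (size S) * (\<Sum>s\<in>#S. u (\<phi> s x))" for u x
    by (simp only: averaging_op_def \<Gamma>_def schreier_graph_def multigraph.simps size_image_mset
        image_mset.compositionality o_def)
  have rayleigh: "(\<Sum>x\<in>E. u x * averaging_op \<Gamma> u x) \<le> (1 - \<epsilon>) * (\<Sum>x\<in>E. (u x)\<^sup>2)"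
    if "(\<Sum>x\<in>E. u x) = 0" for u
    using mean_zero_rayleigh_le[OF reg d _ \<epsilon>(1), of u] card \<epsilon>(2) that by (simp add: V \<Gamma>_def[symmetric])
  have mz: "(\<Sum>x\<in>E. Re (f x)) = 0" "(\<Sum>x\<in>E. Im (f x)) = 0"
    using sum_f by (simp_all flip: Re_sum Im_sum)
  \<comment> \<open>Since \<open>cmod (f x) = 1\<close>, the left side is the average over
    \<open>S\<close> of the real part of \<open>cnj (f x) * f (\<phi> s x)\<close>, that is, of the
    edge labels.\<close>
  have loc: "Re (f x) * averaging_op \<Gamma> (\<lambda>y. Re (f y)) x + Im (f x) * averaging_op \<Gamma> (\<lambda>y. Im (f y)) x > 1 - \<epsilon>"
    if x: "x \<in> E" for x
  proof -
    have eq: "Re (\<chi> (edge_elt G (c x) s)) = Re (f x) * Re (f (\<phi> s x)) + Im (f x) * Im (f (\<phi> s x))"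
      if s: "s \<in># S" for s
    proof -
      have "(Re (f x))\<^sup>2 + (Im (f x))\<^sup>2 = 1" using f1[OF x] by (simp add: cmod_def)
      moreover have "Re (f x) * Re (f (\<phi> s x)) + Im (f x) * Im (f (\<phi> s x)) =
          Re (\<chi> (edge_elt G (c x) s)) * ((Re (f x))\<^sup>2 + (Im (f x))\<^sup>2)"
        by (simp add: step(2)[OF x SG[OF s]] power2_eq_square algebra_simps)
      ultimately show ?thesis by simp
    qed
    have "real (size S) * (1 - \<epsilon>) < (\<Sum>s\<in>#S. Re (\<chi> (edge_elt G (c x) s)))"
      using close[OF cH[OF x]] by (intro sum_mset_gt_size_mult S(2)) auto
    also have "\<dots> = (\<Sum>s\<in>#S. Re (f x) * Re (f (\<phi> s x)) + Im (f x) * Im (f (\<phi> s x)))"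
      by (intro arg_cong[of _ _ sum_mset] image_mset_cong eq)
    also have "\<dots> = Re (f x) * (\<Sum>s\<in>#S. Re (f (\<phi> s x))) + Im (f x) * (\<Sum>s\<in>#S. Im (f (\<phi> s x)))"
      by (simp only: sum_mset.distrib sum_mset_distrib_left)
    also have "\<dots> = real (size S) * (Re (f x) * averaging_op \<Gamma> (\<lambda>y. Re (f y)) x +
        Im (f x) * averaging_op \<Gamma> (\<lambda>y. Im (f y)) x)"
    proof -
      have "a * P + b * Q = n * (a * (1 / n * P) + b * (1 / n * Q))" if "n > 0" for a b P Q n :: real
        using that by (simp add: field_simps)
      thus ?thesis unfolding avg using d by (simp only: of_nat_0_less_iff)
    qed
    finally show ?thesis using d by simp
  qed
  \<comment> \<open>The gap applies to the real and imaginary parts separately; as \<open>f\<close>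
    has modulus 1, the strict chain ends where it began.\<close>
  have "(\<Sum>x\<in>E. 1 - \<epsilon>) < (\<Sum>x\<in>E. Re (f x) * averaging_op \<Gamma> (\<lambda>y. Re (f y)) x + Im (f x) * averaging_op \<Gamma> (\<lambda>y. Im (f y)) x)"
    using fin w loc by (intro sum_strict_mono) auto
  also have "\<dots> \<le> (1 - \<epsilon>) * (\<Sum>x\<in>E. (Re (f x))\<^sup>2) + (1 - \<epsilon>) * (\<Sum>x\<in>E. (Im (f x))\<^sup>2)"
    using rayleigh[OF mz(1)] rayleigh[OF mz(2)] by (simp add: sum.distrib)
  also have "\<dots> = (1 - \<epsilon>) * (\<Sum>x\<in>E. (cmod (f x))\<^sup>2)"
    by (simp add: cmod_power2 sum.distrib distrib_left)
  also have "\<dots> = (\<Sum>x\<in>E. 1 - \<epsilon>)" using f1 by (simp add: mult.commute)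
  finally show False by simp
qed

section \<open>Bounding the index\<close>

text \<open>\<open>K\<close> contains all commutators of \<open>H\<close>: \<open>h k h^-1\<close>
  is a commutator times \<open>k\<close>, and \<open>a b\<close> and \<open>b a\<close> differ by a
  commutator.\<close>

lemma (in group) normal_of_derived_subset:
  assumes H: "subgroup H G" and K: "subgroup K G" "derived G H \<subseteq> K" "K \<subseteq> H"
  shows "K \<lhd> G\<lparr>carrier := H\<rparr>" "comm_group (G\<lparr>carrier := H\<rparr> Mod K)"
proof -
  have HG: "h \<in> carrier G" if "h \<in> H" for h using H that by (rule subgroup.mem_carrier)
  interpret GH: group "G\<lparr>carrier := H\<rparr>" using subgroup_imp_group[OF H] .
  have comm: "h \<otimes> h' \<otimes> inv h \<otimes> inv h' \<in> K" if "h \<in> H" "h' \<in> H" for h h'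
    using that K(2) unfolding derived_def by (blast intro: generate.incl)
  have KH: "subgroup K (G\<lparr>carrier := H\<rparr>)" using subgroup_incl[OF K(1) H K(3)] .
  show normal: "K \<lhd> G\<lparr>carrier := H\<rparr>"
    unfolding GH.normal_inv_iff
  proof (intro conjI ballI KH)
    fix h k assume "h \<in> carrier (G\<lparr>carrier := H\<rparr>)" "k \<in> K"
    hence hk: "h \<in> H" "k \<in> K" "k \<in> H" using K(3) by auto
    have "h \<otimes> k \<otimes> inv h = (h \<otimes> k \<otimes> inv h \<otimes> inv k) \<otimes> k"
      using HG[OF hk(1)] HG[OF hk(3)] by (simp add: m_assoc)
    hence "h \<otimes> k \<otimes> inv h \<in> K" using comm[OF hk(1,3)] hk(2) subgroup.m_closed[OF K(1)] by metis
    thus "h \<otimes>\<^bsub>G\<lparr>carrier := H\<rparr>\<^esub> k \<otimes>\<^bsub>G\<lparr>carrier := H\<rparr>\<^esub> inv\<^bsub>G\<lparr>carrier := H\<rparr>\<^esub> h \<in> K"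
      using hk H by (simp add: m_inv_consistent)
  qed
  interpret N: normal K "G\<lparr>carrier := H\<rparr>" by (fact normal)
  show "comm_group (G\<lparr>carrier := H\<rparr> Mod K)"
  proof (rule group.group_comm_groupI[OF N.factorgroup_is_group])
    fix A B assume "A \<in> carrier (G\<lparr>carrier := H\<rparr> Mod K)" "B \<in> carrier (G\<lparr>carrier := H\<rparr> Mod K)"
    then obtain a b where ab: "a \<in> H" "b \<in> H" "A = K #> a" "B = K #> b"
      by (auto simp: carrier_FactGroup)
    have "a \<otimes> b \<otimes> inv (b \<otimes> a) \<in> K"
      using comm[OF ab(1,2)] HG[OF ab(1)] HG[OF ab(2)] by (simp add: inv_mult_group m_assoc)
    hence "a \<otimes> b \<in> K #> (b \<otimes> a)"
      using subgroup.rcos_module_rev[OF K(1) is_group, of "b \<otimes> a" "a \<otimes> b"] HG[OF ab(1)] HG[OF ab(2)] by simp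
    hence "K #> (b \<otimes> a) = K #> (a \<otimes> b)"
      using repr_independence[of "a \<otimes> b" K "b \<otimes> a"] K(1) HG[OF ab(1)] HG[OF ab(2)] by simp
    thus "A \<otimes>\<^bsub>G\<lparr>carrier := H\<rparr> Mod K\<^esub> B = B \<otimes>\<^bsub>G\<lparr>carrier := H\<rparr> Mod K\<^esub> A"
      using N.rcos_sum[of a b] N.rcos_sum[of b a] ab by simp
  qed
qed

section \<open>Finiteness above the stabilizer and the pigeonhole argument\<close>

context transitive_action begin

text \<open>The map \<open>g w \<mapsto> H g^-1\<close> from points to cosets is onto.\<close>

lemma card_rcosets_le:
  assumes fin: "finite E" and w: "w \<in> E" and H: "subgroup H G" "stabilizer G \<phi> w \<subseteq> H"
  shows "finite (rcosets H)" "card (rcosets H) \<le> card E"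
proof -
  interpret group G using group_hom group_hom.axioms(1) by auto
  have "\<exists>g\<in>carrier G. \<phi> g w = x" if "x \<in> E" for x using unique_orbit[OF w that] .
  then obtain \<gamma> where \<gamma>: "\<And>x. x \<in> E \<Longrightarrow> \<gamma> x \<in> carrier G" "\<And>x. x \<in> E \<Longrightarrow> \<phi> (\<gamma> x) w = x" by metis
  have sub: "rcosets H \<subseteq> (\<lambda>x. H #> inv (\<gamma> x)) ` E"
  proof
    fix C assume "C \<in> rcosets H"
    then obtain g where g: "g \<in> carrier G" "C = H #> g" by (auto simp: RCOSETS_def)
    have x: "\<phi> (inv g) w \<in> E" using element_image[OF _ w refl] g by simp
    have "H #> inv (inv g) = H #> inv (\<gamma> (\<phi> (inv g) w))"
      using g \<gamma>[OF x] by (intro rcoset_inv_cong[OF w _ _ _ H]) auto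
    thus "C \<in> (\<lambda>x. H #> inv (\<gamma> x)) ` E" using g x by auto
  qed
  show "finite (rcosets H)" using finite_subset[OF sub] fin by simp
  have "card (rcosets H) \<le> card ((\<lambda>x. H #> inv (\<gamma> x)) ` E)" using sub fin by (intro card_mono) auto
  also have "\<dots> \<le> card E" using fin by (rule card_image_le)
  finally show "card (rcosets H) \<le> card E" .
qed

text \<open>A subgroup above the stabilizer is determined by its orbit of \<open>w\<close>, a subset
  of \<open>E\<close>. So the maximum in \<open>Theta\<close> is over a finite set.\<close>

lemma finite_subgroups_above_stabilizer:
  assumes fin: "finite E" and w: "w \<in> E"
  shows "finite {H. subgroup H G \<and> stabilizer G \<phi> w \<subseteq> H}"
proof (rule inj_on_finite)
  interpret group G using group_hom group_hom.axioms(1) by auto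
  let ?f = "\<lambda>H. (\<lambda>h. \<phi> h w) ` H"
  have le: "H \<subseteq> K" if H: "subgroup H G" and K: "subgroup K G" "stabilizer G \<phi> w \<subseteq> K" and eq: "?f H = ?f K" for H K
  proof
    fix h assume h: "h \<in> H"
    then obtain k where k: "k \<in> K" "\<phi> h w = \<phi> k w" using eq by (metis (no_types, lifting) imageE imageI)
    have G: "h \<in> carrier G" "k \<in> carrier G" using h k H K subgroup.mem_carrier by metis+
    have "inv k \<otimes> h \<in> K" using diff_in_stabilizer[OF w G k(2)] K(2) by blast
    hence "k \<otimes> (inv k \<otimes> h) \<in> K" using k K(1) subgroup.m_closed by metis
    thus "h \<in> K" using G by (simp add: m_assoc[symmetric])
  qed
  show "inj_on ?f {H. subgroup H G \<and> stabilizer G \<phi> w \<subseteq> H}"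
  proof (rule inj_onI)
    fix H K
    assume "H \<in> {H. subgroup H G \<and> stabilizer G \<phi> w \<subseteq> H}"
      "K \<in> {H. subgroup H G \<and> stabilizer G \<phi> w \<subseteq> H}" "?f H = ?f K"
    thus "H = K" using le[of H K] le[of K H] by auto
  qed
  show "?f ` {H. subgroup H G \<and> stabilizer G \<phi> w \<subseteq> H} \<subseteq> Pow E"
    using element_image[OF _ w refl] by (auto dest: subgroup.mem_carrier)
qed (use fin in simp)

lemma card_abelian_quotient_square_le:
  assumes fin: "finite E" and card: "card E \<ge> 2" and w: "w \<in> E"
    and S: "symmetric_mset G S" "S \<noteq> {#}"
    and \<epsilon>: "\<epsilon> > 0" "gap (schreier_graph E \<phi> S) \<ge> \<epsilon>"
    and H: "subgroup H G"
    and K: "subgroup K G" "stabilizer G \<phi> w \<subseteq> K" "derived G H \<subseteq> K" "K \<subseteq> H"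
    and q: "q \<ge> 4" "1 - cos (2 * pi / q) \<le> \<epsilon>"
  shows "(card (rcosets\<^bsub>G\<lparr>carrier := H\<rparr>\<^esub> K))\<^sup>2 \<le> q ^ (size S * card (rcosets H))"
proof (rule ccontr)
  interpret group G using group_hom group_hom.axioms(1) by auto
  define A where "A = G\<lparr>carrier := H\<rparr> Mod K"
  assume "\<not> ?thesis"
  hence large: "q ^ (size S * card (rcosets H)) < (card (carrier A))\<^sup>2"
    by (simp add: A_def FactGroup_def)
  interpret N: normal K "G\<lparr>carrier := H\<rparr>" using normal_of_derived_subset(1)[OF H K(1,3,4)] .
  interpret A: comm_group A unfolding A_def using normal_of_derived_subset(2)[OF H K(1,3,4)] .
  have stH: "stabilizer G \<phi> w \<subseteq> H" using K by blast
  have HG: "h \<in> carrier G" if "h \<in> H" for h using H that by (rule subgroup.mem_carrier)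
  have SG: "s \<in> carrier G" if "s \<in># S" for s using S(1) that by (auto simp: symmetric_mset_def)
  have inA: "K #> h \<in> carrier A" if "h \<in> H" for h using that by (auto simp: A_def carrier_FactGroup)
  have exA: "\<exists>h\<in>H. a = K #> h" if "a \<in> carrier A" for a using that by (auto simp: A_def carrier_FactGroup)
  have multA: "(K #> h) \<otimes>\<^bsub>A\<^esub> (K #> k) = K #> (h \<otimes> k)" if "h \<in> H" "k \<in> H" for h k
    using N.rcos_sum[of h k] that by (simp add: A_def)
  have Kk: "K #> k = \<one>\<^bsub>A\<^esub>" if "k \<in> K" for k
    using coset_join2[of k K] that K(1) subgroup.mem_carrier[OF K(1) that] by (simp add: A_def)
  have "carrier A \<subseteq> rcosets K"
    using HG by (auto simp: A_def carrier_FactGroup RCOSETS_def)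
  hence finA: "finite (carrier A)" using card_rcosets_le(1)[OF fin w K(1,2)] finite_subset by blast
  obtain F where F12: "finite F" "card (carrier A) \<le> card F"
    and F3: "\<forall>\<chi>\<in>F. unit_character A (carrier A) \<chi>"
    by (rule A.ex_many_unit_characters[OF finA])
  note F = F12 bspec[OF F3]
  have unit: "cmod (\<chi> (K #> h)) = 1" if "\<chi> \<in> F" "h \<in> H" for \<chi> h
    using F(3)[OF that(1)] inA[OF that(2)] by (auto simp: unit_character_def)
  have mult: "\<chi> (K #> (h \<otimes> k)) = \<chi> (K #> h) * \<chi> (K #> k)" if "\<chi> \<in> F" "h \<in> H" "k \<in> H" for \<chi> h k
    using F(3)[OF that(1)] inA[OF that(2)] inA[OF that(3)] multA[OF that(2,3)]
    unfolding unit_character_def by metis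
  have one: "\<chi> (K #> k) = 1" if "\<chi> \<in> F" "k \<in> K" for \<chi> k
    using A.unit_character_one[OF A.subgroup_self F(3)[OF that(1)]] Kk[OF that(2)] by simp
  have inv: "\<chi> (K #> inv h) = cnj (\<chi> (K #> h))" if "\<chi> \<in> F" "h \<in> H" for \<chi> h
  proof -
    have "\<chi> (K #> h) * \<chi> (K #> inv h) = 1"
      using mult[OF that subgroup.m_inv_closed[OF H that(2)]] one[OF that(1), of \<one>] HG[OF that(2)]
        subgroup.one_closed[OF K(1)] by simp
    moreover have "\<chi> (K #> h) * cnj (\<chi> (K #> h)) = 1"
      using unit[OF that] complex_norm_square[of "\<chi> (K #> h)"] by simp
    moreover have "\<chi> (K #> h) \<noteq> 0" using unit[OF that] by auto
    ultimately show ?thesis by (metis mult_cancel_left)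
  qed
  \<comment> \<open>Copies of a repeated element are numbered from 0, so that \<open>D\<close> has
    exactly \<open>size S * card (rcosets H)\<close> elements.\<close>
  define copies where "copies = Sigma (set_mset S) (\<lambda>s. {..<count S s})"
  define D where "D = copies \<times> rcosets H"
  \<comment> \<open>Edge reversal; the copy number can be kept because \<open>s\<close> and
    \<open>inv s\<close> have equal multiplicity in \<open>S\<close>.\<close>
  define \<tau> where "\<tau> = (\<lambda>((s, i), C). ((inv s, i :: nat), C #> inv s))"
  define val where "val \<chi> = (\<lambda>((s, i :: nat), C). \<chi> (K #> edge_elt G C s))" for \<chi> :: "'a set \<Rightarrow> complex"
  have finR: "finite (rcosets H)" using card_rcosets_le(1)[OF fin w H stH] .
  have "card copies = size S"
    unfolding copies_def by (simp add: size_multiset_overloaded_eq)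
  hence cardD: "card D = size S * card (rcosets H)" by (simp add: D_def card_cartesian_product)
  have finD: "finite D" using finR by (simp add: D_def copies_def)
  obtain \<chi> \<chi>' where \<chi>: "\<chi> \<in> F" "\<chi>' \<in> F" "\<chi> \<noteq> \<chi>'"
    and close: "\<And>e. e \<in> D \<Longrightarrow> Re (val \<chi> e * cnj (val \<chi>' e)) > cos (2 * pi / q)"
  proof (rule ex_close_unit_labellings[OF finD F(1), of \<tau> val q])
    show "4 \<le> q" by (rule q(1))
    show "q ^ card D < (card F)\<^sup>2"
      unfolding cardD using large by (rule order_less_le_trans) (rule power_mono[OF F(2) zero_le])
    fix e assume "e \<in> D"
    then obtain s i C where e: "e = ((s, i), C)" "s \<in># S" "i < count S s" "C \<in> rcosets H"
      by (auto simp: D_def copies_def)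
    have cnt: "count S (inv s) = count S s" using S(1) SG[OF e(2)] by (simp add: symmetric_mset_def)
    hence inS: "inv s \<in># S" using e(3) by (simp flip: count_greater_zero_iff)
    have C': "C #> inv s \<in> rcosets H" using rcosets_translate[OF H e(4)] SG[OF e(2)] by simp
    show "\<tau> e \<in> D" using e cnt inS C' by (simp add: \<tau>_def D_def copies_def)
    have "C #> inv s #> s = C"
      using SG[OF e(2)] subgroup.rcosets_carrier[OF H is_group e(4)] by (simp add: coset_mult_assoc)
    thus "\<tau> (\<tau> e) = e" using e SG[OF e(2)] by (simp add: \<tau>_def)
    fix \<chi> assume \<chi>: "\<chi> \<in> F"
    have eH: "edge_elt G C s \<in> H" using edge_elt_closed[OF H e(4) SG[OF e(2)]] .
    show "cmod (val \<chi> e) = 1" using unit[OF \<chi> eH] by (simp add: val_def e)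
    show "val \<chi> (\<tau> e) = cnj (val \<chi> e)"
      using inv[OF \<chi> eH] edge_elt_inv[OF H e(4) SG[OF e(2)]] by (simp add: val_def \<tau>_def e)
  qed (rule that)
  define \<psi> where "\<psi> h = \<chi> (K #> h) * cnj (\<chi>' (K #> h))" for h
  \<comment> \<open>Distinct characters differ somewhere on \<open>carrier A\<close>, and every
    element of \<open>A\<close> is the coset of some element of \<open>H\<close>.\<close>
  have "\<exists>h0\<in>H. \<chi> (K #> h0) \<noteq> \<chi>' (K #> h0)"
  proof (rule ccontr)
    assume "\<not> ?thesis"
    hence "\<chi> a = \<chi>' a" if "a \<in> carrier A" for a using exA[OF that] by auto
    moreover have "\<chi> \<in> extensional (carrier A)" "\<chi>' \<in> extensional (carrier A)"
      using F(3) \<chi> by (auto simp: unit_character_def)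
    ultimately have "\<chi> = \<chi>'" using extensionalityI[of \<chi> "carrier A" \<chi>'] by blast
    thus False using \<chi>(3) by blast
  qed
  then obtain h0 where h0: "h0 \<in> H" "\<chi> (K #> h0) \<noteq> \<chi>' (K #> h0)" by blast
  have "\<psi> h0 \<noteq> 1"
  proof
    assume "\<psi> h0 = 1"
    hence "\<chi> (K #> h0) * (cnj (\<chi>' (K #> h0)) * \<chi>' (K #> h0)) = \<chi>' (K #> h0)"
      by (simp add: \<psi>_def flip: mult.assoc)
    moreover have "cnj (\<chi>' (K #> h0)) * \<chi>' (K #> h0) = 1"
      using unit[OF \<chi>(2) h0(1)] complex_norm_square[of "\<chi>' (K #> h0)"]
      by (simp add: mult.commute)
    ultimately show False using h0 by simp
  qed
  have "\<exists>C\<in>rcosets H. \<exists>s\<in>#S. Re (\<psi> (edge_elt G C s)) \<le> 1 - \<epsilon>"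
  proof (rule ex_edge_far_from_one[OF fin card w S \<epsilon> H stH])
    show "cmod (\<psi> h) = 1" if "h \<in> H" for h
      using unit[OF \<chi>(1) that] unit[OF \<chi>(2) that] by (simp add: \<psi>_def norm_mult)
    show "\<psi> (h \<otimes> k) = \<psi> h * \<psi> k" if "h \<in> H" "k \<in> H" for h k
      using mult[OF \<chi>(1) that] mult[OF \<chi>(2) that] by (simp add: \<psi>_def)
    show "\<psi> k = 1" if "k \<in> stabilizer G \<phi> w" for k
      using one[OF \<chi>(1)] one[OF \<chi>(2)] that K(2) by (auto simp: \<psi>_def)
  qed fact+
  then obtain C s where "C \<in> rcosets H" "s \<in># S" "Re (\<psi> (edge_elt G C s)) \<le> 1 - \<epsilon>" by blast
  moreover from this have "((s, 0), C) \<in> D" by (simp add: D_def copies_def)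
  ultimately show False using close[of "((s, 0), C)"] q(2) by (simp add: val_def \<psi>_def)
qed

end

text \<open>
  For \<open>\<epsilon> > 5 / 4\<close> the multigraph is complete on \<open>n \<le> 4\<close> vertices and \<open>\<epsilon> \<le> n / (n - 1)\<close>.
\<close>
lemma square_card_le_of_large_gap:
  assumes reg: "regular_graph d \<Gamma>" and d: "d > 0" and card: "card (vertices \<Gamma>) \<ge> 2"
    and \<epsilon>: "\<epsilon> > 5 / 4" "gap \<Gamma> \<ge> \<epsilon>" and excl: "\<not> (card (vertices \<Gamma>) = 2 \<and> d = 1)"
  shows "(real (card (vertices \<Gamma>)))\<^sup>2 \<le> (5 / \<epsilon>) ^ d"
proof -
  define n where "n = card (vertices \<Gamma>)"
  have n: "n \<ge> 2" "n \<le> Suc d" "(\<epsilon> - 1) * (real n - 1) \<le> 1"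
    using card card_vertices_le_Suc_degree[OF reg d _ \<epsilon>(2)] gap_le[OF reg d card _ \<epsilon>(2)] \<epsilon>(1)
    by (simp_all add: n_def)
  have "1 / 4 * (real n - 1) \<le> (\<epsilon> - 1) * (real n - 1)"
    using \<epsilon>(1) n(1) by (intro mult_right_mono) auto
  hence "1 / 4 * (real n - 1) \<le> 1" using n(3) by (rule order.trans)
  hence "n \<le> 5" by simp
  \<comment> \<open>In the cases below, \<open>b\<close> is \<open>5 * (n - 1) / n\<close>, the
    least value of \<open>5 / \<epsilon>\<close> that the gap bound allows, and \<open>k\<close> is
    the least possible degree; for \<open>n = 2\<close> it is 2 because degree 1 is
    excluded.\<close>
  have bound: "(real n)\<^sup>2 \<le> (5 / \<epsilon>) ^ d" if "(real n)\<^sup>2 \<le> b ^ k" "1 \<le> b" "b * \<epsilon> \<le> 5" "k \<le> d" for b k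
  proof -
    have b: "b \<le> 5 / \<epsilon>" using that(3) \<epsilon>(1) by (simp add: pos_le_divide_eq)
    have "b ^ k \<le> b ^ d" using that by (intro power_increasing) auto
    also have "\<dots> \<le> (5 / \<epsilon>) ^ d" using b that by (intro power_mono) auto
    finally show ?thesis using that by simp
  qed
  have "n \<noteq> 5"
  proof
    assume "n = 5"
    hence "(\<epsilon> - 1) * 4 \<le> 1" using n(3) by simp
    thus False using \<epsilon>(1) by simp
  qed
  then consider "n = 2" | "n = 3" | "n = 4" using n(1) \<open>n \<le> 5\<close> by linarith
  hence "(real n)\<^sup>2 \<le> (5 / \<epsilon>) ^ d"
  proof cases
    case 1
    hence "d \<noteq> 1" using excl by (simp add: n_def)
    thus ?thesis using 1 n d by (intro bound[of "5 / 2" 2]) (auto simp: power2_eq_square)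
  next
    case 2
    thus ?thesis using n by (intro bound[of "10 / 3" 2]) (auto simp: power2_eq_square)
  next
    case 3
    thus ?thesis using n by (intro bound[of "15 / 4" 3]) (auto simp: power2_eq_square power3_eq_cube)
  qed
  thus ?thesis unfolding n_def .
qed

lemma (in transitive_action) square_index_le:
  assumes fin: "finite E" and card: "card E \<ge> 2" and w: "w \<in> E"
    and S: "symmetric_mset G S" "S \<noteq> {#}"
    and \<epsilon>: "\<epsilon> > 0" "gap (schreier_graph E \<phi> S) \<ge> \<epsilon>"
    and excl: "\<not> (card E = 2 \<and> size S = 1 \<and> \<epsilon> > 5 / 4)"
    and H: "subgroup H G"
    and K: "subgroup K G" "stabilizer G \<phi> w \<subseteq> K" "derived G H \<subseteq> K" "K \<subseteq> H"
  shows "(real (card (rcosets\<^bsub>G\<lparr>carrier := H\<rparr>\<^esub> K)))\<^sup>2 \<le> (5 / \<epsilon>) ^ (size S * card (rcosets H))"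
proof -
  interpret group G using group_hom group_hom.axioms(1) by auto
  define m where "m = card (rcosets\<^bsub>G\<lparr>carrier := H\<rparr>\<^esub> K)"
  define n where "n = card (rcosets H)"
  show ?thesis unfolding m_def[symmetric] n_def[symmetric]
  proof (cases "\<epsilon> \<le> 5 / 4")
    case True
    define q where "q = nat \<lfloor>5 / \<epsilon>\<rfloor>"
    note q = one_minus_cos_floor_le[OF \<epsilon>(1) True, folded q_def]
    have "m\<^sup>2 \<le> q ^ (size S * n)"
      unfolding m_def n_def by (rule card_abelian_quotient_square_le[OF fin card w S \<epsilon> H K q(1,3)])
    hence "(real m)\<^sup>2 \<le> real q ^ (size S * n)" by (simp flip: of_nat_power)
    also have "\<dots> \<le> (5 / \<epsilon>) ^ (size S * n)" using q(2) by (intro power_mono) auto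
    finally show "(real m)\<^sup>2 \<le> (5 / \<epsilon>) ^ (size S * n)" .
  next
    case False
    define \<Gamma> where "\<Gamma> = schreier_graph E \<phi> S"
    have reg: "regular_graph (size S) \<Gamma>"
      unfolding \<Gamma>_def using schreier_graph_regular[OF group_action_axioms fin S(1)] .
    have V: "vertices \<Gamma> = E" by (simp add: \<Gamma>_def schreier_graph_def)
    have d: "size S > 0" using S(2) by (simp add: nonempty_has_size)
    have "rcosets\<^bsub>G\<lparr>carrier := H\<rparr>\<^esub> K \<subseteq> rcosets K"
      using subgroup.mem_carrier[OF H] by (auto simp: RCOSETS_def)
    hence "m \<le> card (rcosets K)"
      unfolding m_def by (rule card_mono[OF card_rcosets_le(1)[OF fin w K(1,2)]])
    also have "\<dots> \<le> card E" by (rule card_rcosets_le(2)[OF fin w K(1,2)])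
    finally have "(real m)\<^sup>2 \<le> (real (card E))\<^sup>2" by (simp add: power_mono)
    also have "\<dots> \<le> (5 / \<epsilon>) ^ size S"
      using square_card_le_of_large_gap[OF reg d] card excl False \<epsilon>(2) by (simp add: V \<Gamma>_def[symmetric])
    also have "\<dots> \<le> (5 / \<epsilon>) ^ (size S * n)"
    proof (rule power_increasing)
      have "rcosets H \<noteq> {}" using rcosetsI[of H \<one>] subgroup.subset[OF H] by auto
      hence "n > 0" using card_rcosets_le(1)[OF fin w H] K unfolding n_def by (simp add: card_gt_0_iff)
      thus "size S \<le> size S * n" by simp
      \<comment> \<open>Raising the exponent needs a base of at least 1; on two or more points the
        gap bound gives \<open>\<epsilon> \<le> 2\<close>.\<close>
      have "(\<epsilon> - 1) * 1 \<le> (\<epsilon> - 1) * (real (card E) - 1)" using False card by (intro mult_left_mono) auto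
      also have "\<dots> \<le> 1" using gap_le[OF reg d _ \<epsilon>(1)] card \<epsilon>(2) by (simp add: V \<Gamma>_def[symmetric])
      finally show "1 \<le> 5 / \<epsilon>" using \<epsilon>(1) by (simp add: pos_le_divide_eq)
    qed
    finally show "(real m)\<^sup>2 \<le> (5 / \<epsilon>) ^ (size S * n)" .
  qed
qed

section \<open>From index bounds to \<open>Theta\<close>\<close>

lemma (in transitive_action) Theta_attained:
  assumes fin: "finite E" and w: "w \<in> E"
  obtains H K where "subgroup H G" "subgroup K G" "stabilizer G \<phi> w \<subseteq> K" "derived G H \<subseteq> K" "K \<subseteq> H"
    "Theta G \<phi> w = real (card (rcosets\<^bsub>G\<lparr>carrier := H\<rparr>\<^esub> K)) powr (1 / real (card (rcosets H)))"
proof -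
  interpret group G using group_hom group_hom.axioms(1) by auto
  let ?T = "stabilizer G \<phi> w"
  let ?g = "\<lambda>H. real (subgroup_index G H (derived G H <#> ?T)) powr (1 / real (subgroup_index G (carrier G) H))"
  let ?A = "{H. subgroup H G \<and> ?T \<subseteq> H}"
  have "?g ` ?A = {?g H | H. subgroup H G \<and> ?T \<subseteq> H}" by blast
  moreover have "finite (?g ` ?A)" using finite_subgroups_above_stabilizer[OF fin w] by simp
  moreover have "carrier G \<in> ?A" using subgroup_self stabilizer_subset by blast
  hence "?g ` ?A \<noteq> {}" by blast
  ultimately have "Theta G \<phi> w \<in> ?g ` ?A" unfolding Theta_def by (metis (no_types, lifting) Max_in)
  then obtain H where H: "subgroup H G" "?T \<subseteq> H" "Theta G \<phi> w = ?g H" by blast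
  define K where "K = derived G H <#> ?T"
  have T: "subgroup ?T G" using stabilizer_subgroup[OF w] .
  have D: "subgroup (derived G H) G" using derived_is_subgroup[OF subgroup.subset[OF H(1)]] .
  \<comment> \<open>The derived subgroup is normal in \<open>H\<close>, so its product with the
    stabilizer is a subgroup.\<close>
  have "subgroup K (G\<lparr>carrier := H\<rparr>)"
    unfolding K_def using mult_norm_sub_in_sub[OF derived_subgroup_is_normal[OF H(1)] _ H(1)] subgroup_incl[OF T H(1,2)] by blast
  hence K: "subgroup K G" "K \<subseteq> H"
    using incl_subgroup[OF H(1)] subgroup.subset by fastforce+
  have "t \<in> K" if "t \<in> ?T" for t
  proof -
    have "\<one> \<otimes> t \<in> K" unfolding K_def set_mult_def using that subgroup.one_closed[OF D] by blast
    thus ?thesis using subgroup.mem_carrier[OF T that] by simp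
  qed
  moreover have "x \<in> K" if "x \<in> derived G H" for x
  proof -
    have "x \<otimes> \<one> \<in> K" unfolding K_def set_mult_def using that subgroup.one_closed[OF T] by blast
    thus ?thesis using subgroup.mem_carrier[OF D that] by simp
  qed
  ultimately show thesis
    using that[OF H(1) K(1) _ _ K(2)] H(3) unfolding K_def[symmetric] subgroup_index_def by (simp add: subset_iff)
qed

text \<open>Logarithms of the squared index bound at the maximising \<open>H\<close> give the claim.
  The excluded case is a single edge on two points, where \<open>Theta\<close> is 2 and the
  inequality is false for \<open>\<epsilon> > 5 / 4\<close>.\<close>

theorem theorem1p3:
  fixes G :: "('g, 'm) monoid_scheme" (structure)
    and \<Omega> :: "'x set" and \<phi> :: "'g \<Rightarrow> 'x \<Rightarrow> 'x" and \<omega> :: 'x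
    and S :: "'g multiset" and \<epsilon> :: real
  assumes "transitive_action G \<Omega> \<phi>" and "finite \<Omega>" and "\<omega> \<in> \<Omega>"
    and "symmetric_mset G S" and "S \<noteq> {#}"
    and "\<epsilon> > 0" and "gap (schreier_graph \<Omega> \<phi> S) \<ge> \<epsilon>"
    and "\<not> (card \<Omega> = 2 \<and> size S = 1 \<and> \<epsilon> > 5 / 4)"
  shows "real (size S) \<ge> 2 * ln (Theta G \<phi> \<omega>) / ln (5 / \<epsilon>)"
proof -
  interpret transitive_action G \<Omega> \<phi> by fact
  interpret group G using group_hom group_hom.axioms(1) by auto
  obtain H K where H: "subgroup H G"
    and K: "subgroup K G" "stabilizer G \<phi> \<omega> \<subseteq> K" "derived G H \<subseteq> K" "K \<subseteq> H"
    and \<Theta>: "Theta G \<phi> \<omega> = real (card (rcosets\<^bsub>G\<lparr>carrier := H\<rparr>\<^esub> K)) powr (1 / real (card (rcosets H)))"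
    by (rule Theta_attained[OF assms(2,3)])
  define m where "m = card (rcosets\<^bsub>G\<lparr>carrier := H\<rparr>\<^esub> K)"
  define n where "n = card (rcosets H)"
  have sub: "rcosets\<^bsub>G\<lparr>carrier := H\<rparr>\<^esub> K \<subseteq> rcosets K"
    using subgroup.mem_carrier[OF H] by (auto simp: RCOSETS_def)
  note R = card_rcosets_le[OF assms(2,3) K(1,2)]
  have "K #> \<one> \<in> rcosets\<^bsub>G\<lparr>carrier := H\<rparr>\<^esub> K"
    using subgroup.one_closed[OF H] by (auto simp: RCOSETS_def)
  hence m: "m > 0" using finite_subset[OF sub R(1)] by (auto simp: m_def card_gt_0_iff)
  have mle: "m \<le> card \<Omega>" using card_mono[OF R(1) sub] R(2) by (simp add: m_def)
  have "rcosets H \<noteq> {}" using rcosetsI[of H \<one>] subgroup.subset[OF H] by auto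
  hence n: "n > 0"
    using card_rcosets_le(1)[OF assms(2,3) H] K unfolding n_def by (simp add: card_gt_0_iff)
  have ln_\<Theta>: "ln (Theta G \<phi> \<omega>) = ln m / n" using m by (simp add: \<Theta> m_def[symmetric] n_def[symmetric] ln_powr)
  show ?thesis
  proof (cases "card \<Omega> \<ge> 2")
    \<comment> \<open>A single point has no second eigenvalue, but there \<open>Theta\<close> is 1
      and its logarithm is 0.\<close>
    case False
    hence "m = 1" using m mle by simp
    thus ?thesis by (simp add: ln_\<Theta>)
  next
    case True
    define \<Gamma> where "\<Gamma> = schreier_graph \<Omega> \<phi> S"
    have reg: "regular_graph (size S) \<Gamma>"
      unfolding \<Gamma>_def using schreier_graph_regular[OF group_action_axioms assms(2,4)] .
    have V: "vertices \<Gamma> = \<Omega>" by (simp add: \<Gamma>_def schreier_graph_def)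
    have d: "size S > 0" using assms(5) by (simp add: nonempty_has_size)
    \<comment> \<open>This makes the denominator \<open>ln (5 / \<epsilon>)\<close> positive, so
      that it can be cleared.\<close>
    have "\<epsilon> < 5"
    proof (rule ccontr)
      assume "\<not> \<epsilon> < 5"
      hence "4 * 1 \<le> (\<epsilon> - 1) * (real (card \<Omega>) - 1)" using True by (intro mult_mono) auto
      also have "\<dots> \<le> 1" using gap_le[OF reg d _ assms(6)] True assms(7) by (simp add: V \<Gamma>_def[symmetric])
      finally show False by simp
    qed
    hence pos: "ln (5 / \<epsilon>) > 0" using assms(6) by (simp add: ln_gt_zero pos_less_divide_eq)
    have "(real m)\<^sup>2 \<le> (5 / \<epsilon>) ^ (size S * n)"
      unfolding m_def n_def by (rule square_index_le[OF assms(2) True assms(3-8) H K])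
    hence "ln ((real m)\<^sup>2) \<le> ln ((5 / \<epsilon>) ^ (size S * n))" using m assms(6) by (simp add: ln_le_cancel_iff)
    hence "2 * ln m \<le> real (size S * n) * ln (5 / \<epsilon>)" using m assms(6) by (simp add: ln_realpow)
    hence "2 * (ln m / n) \<le> real (size S) * ln (5 / \<epsilon>)" using n by (simp add: pos_divide_le_eq mult_ac)
    thus ?thesis unfolding ln_\<Theta> pos_divide_le_eq[OF pos] by simp
  qed
qed

end
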